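(* Let $\{\mathbf{Y}_n\}_{n\ge1}$ be a pMAX process built from $\{\mathbf{X}_n\}_{n\ge1}$, $\{\mathbf{Z}_n\}_{n\ge1}$ and $\boldsymbol{\alpha}=(\alpha_1,\dots,\alpha_d)$, let $D=\{1,\dots,d\}$ and $U=\{j\in D:\alpha_j\ge1\}$. The multivariate extremal index of $\{\mathbf{Y}_n\}_{n\ge1}$ is given by $$\theta^{\mathbf Y}(\tau_1,\dots,\tau_d)=\frac{\theta^{\mathbf X}_U(\tau_1,\dots,\tau_d)_U\,\log C_{G_U}(e^{-\tau_1},\dots,e^{-\tau_d})_U+\log C_{H_{D-U}}(e^{-\tau_1},\dots,e^{-\tau_d})_{D-U}}{\log C_{G_U}(e^{-\tau_1},\dots,e^{-\tau_d})_U+\log C_{H_{D-U}}(e^{-\tau_1},\dots,e^{-\tau_d})_{D-U}},$$ where $$\theta^{\mathbf X}_U(\tau_1,\dots,\tau_d)_U=\lim_{\tau_j\downarrow0,\ j\in D-U}\theta^{\mathbf X}(\tau_1,\dots,\tau_d).$$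
   Context: Notation: $a\vee b=\max(a,b)$; operations and inequalities on vectors are componentwise. For $A\subset D$, $(x_1,\dots,x_d)_A$ is the sub-vector of $(x_1,\dots,x_d)$ with indexes in $A$, and for a distribution function $F$, $F_A$ is the marginal distribution function of $F$ for the sub-vector with indexes in $A$. $C_F$ denotes the copula of $F$. Convention: if $U=\emptyset$ or $D-U=\emptyset$, the quantities involving the respective sub-distributions (the corresponding terms in the numerator and denominator) are taken to be zero. pMAX process: $\{\mathbf{X}_n=(X_{n,1},\dots,X_{n,d})\}_{n\ge1}$ is a stationary sequence with multivariate extremal index $\theta^{\mathbf X}(\tau_1,\dots,\tau_d)$, with common distribution function $F_{\mathbf X}$ having unit Fréchet marginals $F_{X_j}(x)=\exp(-1/x)$, $x>0$, and in the domain of attraction of a multivariate extreme value distribution $G$, i.e. $C_{F_{\mathbf X}}^n(u_1^{1/n},\dots,u_d^{1/n})\to C_G(u_1,\dots,u_d)$ as $n\to\infty$. $\{\mathbf{Z}_n=(Z_{n,1},\dots,Z_{n,d})\}_{n\ge1}$ is an i.i.d. sequence of random vectors, independent of $\{\mathbf{X}_n\}_{n\ge1}$, with common distribution function $F_{\mathbf Z}$ having unit Fréchet marginals $\exp(-1/x)$, $x>0$, and in the domain of attraction of a multivariate extreme value distribution $H$, i.e. $C_{F_{\mathbf Z}}^n(u_1^{1/n},\dots,u_d^{1/n})\to C_H(u_1,\dots,u_d)$. $\boldsymbol{\alpha}=(\alpha_1,\dots,\alpha_d)$ is a vector of positive real constants. The pMAX process is $\mathbf{Y}_n=(Y_{n,1},\dots,Y_{n,d})$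 with $Y_{n,j}=X_{n,j}\vee Z_{n,j}^{1/\alpha_j}$. Multivariate extremal index: a stationary sequence $\{\mathbf W_n\}_{n\ge1}$ of $d$-dimensional vectors has extremal index $\theta(\boldsymbol\tau)\in[0,1]$ if for each $\boldsymbol\tau=(\tau_1,\dots,\tau_d)\in\mathbb R_+^d$ there exist levels $\mathbf u_n^{(\boldsymbol\tau)}=(u_{n,j}^{(\tau_j)})_{1\le j\le d}$ (normalized levels) such that $n(1-F_{W_{n,j}}(u_{n,j}^{(\tau_j)}))\to\tau_j$ for $j=1,\dots,d$, $P(\widehat{\mathbf M}_n\le\mathbf u_n^{(\boldsymbol\tau)})\to\gamma(\boldsymbol\tau)$ and $P(\mathbf M_n\le\mathbf u_n^{(\boldsymbol\tau)})\to\gamma(\boldsymbol\tau)^{\theta(\boldsymbol\tau)}$, where $\mathbf M_n$ is the vector of componentwise maxima of $\mathbf W_1,\dots,\mathbf W_n$ and $\widehat{\mathbf M}_n$ that of $n$ i.i.d. vectors with the same common distribution.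
   Formalization: The formal statement additionally assumes α_j ≠ 1 for all j; for α_j = 1 the formula fails, e.g. d = 1, α = 1, X_n = max(W_n, W_{n+1})/2 with W_n i.i.d. unit Fréchet gives θ^Y = 3/4, but the formula gives 1/2. *)

theory Defs
  imports "HOL-Probability.Probability"
begin

text \<open>
  Vectors indexed by \<open>D\<close> are functions on a finite type \<open>'d\<close>, so \<open>D = UNIV\<close>; sub-vectors with
  indexes in \<open>A\<close> are elements of the product space over \<open>A\<close>. A multivariate distribution function
  is represented by the probability measure it determines.
\<close>

abbreviation vecs :: "'d set \<Rightarrow> ('d \<Rightarrow> real) measure" where
  "vecs A \<equiv> PiM A (\<lambda>_. borel)"

abbreviation processes :: "(nat \<Rightarrow> 'd \<Rightarrow> real) measure" where
  "processes \<equiv> PiM {1..} (\<lambda>_. vecs UNIV)"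

definition process :: "(nat \<Rightarrow> 'a \<Rightarrow> 'd \<Rightarrow> real) \<Rightarrow> 'a \<Rightarrow> nat \<Rightarrow> 'd \<Rightarrow> real" where
  "process W \<omega> = (\<lambda>n\<in>{1..}. W n \<omega>)"

definition law :: "'a measure \<Rightarrow> ('a \<Rightarrow> 'd \<Rightarrow> real) \<Rightarrow> ('d \<Rightarrow> real) measure" where
  "law M V = distr M (vecs UNIV) V"

definition distribution_on :: "'d set \<Rightarrow> ('d \<Rightarrow> real) measure \<Rightarrow> bool" where
  "distribution_on A F \<longleftrightarrow> prob_space F \<and> sets F = sets (vecs A)"

definition mcdf :: "'d set \<Rightarrow> ('d \<Rightarrow> real) measure \<Rightarrow> ('d \<Rightarrow> real) \<Rightarrow> real" where
  "mcdf A F x = measure F {y \<in> space F. \<forall>j\<in>A. y j \<le> x j}"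

definition marginal :: "('d \<Rightarrow> real) measure \<Rightarrow> 'd set \<Rightarrow> ('d \<Rightarrow> real) measure" where
  "marginal F A = distr F (vecs A) (\<lambda>x. restrict x A)"

definition margin :: "('d \<Rightarrow> real) measure \<Rightarrow> 'd \<Rightarrow> real measure" where
  "margin F j = distr F borel (\<lambda>x. x j)"

definition unit_frechet :: "real measure \<Rightarrow> bool" where
  "unit_frechet \<mu> \<longleftrightarrow> (\<forall>x>0. cdf \<mu> x = exp (- 1 / x))"

definition is_copula :: "'d set \<Rightarrow> (('d \<Rightarrow> real) \<Rightarrow> real) \<Rightarrow> bool" where
  "is_copula A C \<longleftrightarrow>
     (\<exists>K. distribution_on A K \<and> (\<forall>j\<in>A. \<forall>t\<in>{0..1}. cdf (margin K j) t = t) \<and>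
          (\<forall>u. (\<forall>j\<in>A. u j \<in> {0..1}) \<longrightarrow> C u = mcdf A K u))"

text \<open>
  The copula of \<open>F\<close> is the one given by Sklar's theorem. Its values are determined on the unit cube
  when the univariate margins of \<open>F\<close> are continuous, as they are in all uses below; elsewhere the
  choice is arbitrary.
\<close>

definition copula :: "'d set \<Rightarrow> ('d \<Rightarrow> real) measure \<Rightarrow> ('d \<Rightarrow> real) \<Rightarrow> real" where
  "copula A F =
     (SOME C. is_copula A C \<and> (\<forall>x. mcdf A F x = C (\<lambda>j\<in>A. cdf (margin F j) (x j))))"

text \<open>
  Multivariate extreme value distributions: the max-stable distributions with non-degenerate
  univariate margins.
\<close>

definition mev_distribution :: "('d::finite \<Rightarrow> real) measure \<Rightarrow> bool" where
  "mev_distribution G \<longleftrightarrow>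
     distribution_on UNIV G \<and> (\<forall>j c. margin G j \<noteq> return borel c) \<and>
     (\<forall>n::nat. n \<ge> 1 \<longrightarrow> (\<exists>a b. (\<forall>j. 0 < a j) \<and>
        (\<forall>x. mcdf UNIV G (\<lambda>j. a j * x j + b j) ^ n = mcdf UNIV G x)))"

definition in_domain_of_attraction ::
  "('d::finite \<Rightarrow> real) measure \<Rightarrow> ('d \<Rightarrow> real) measure \<Rightarrow> bool" where
  "in_domain_of_attraction F G \<longleftrightarrow> mev_distribution G \<and>
     (\<forall>u. (\<forall>j. u j \<in> {0..1}) \<longrightarrow>
        (\<lambda>n. copula UNIV F (\<lambda>j. u j powr (1 / real n)) ^ n) \<longlonglongrightarrow> copula UNIV G u)"

text \<open>Sequences are indexed by \<open>n \<ge> 1\<close>; the term at index 0 plays no role.\<close>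

definition stationary :: "'a measure \<Rightarrow> (nat \<Rightarrow> 'a \<Rightarrow> 'd::finite \<Rightarrow> real) \<Rightarrow> bool" where
  "stationary M W \<longleftrightarrow>
     (\<forall>n\<ge>1. W n \<in> measurable M (vecs UNIV)) \<and>
     (\<forall>k. distr M processes (process (\<lambda>n. W (n + k))) = distr M processes (process W))"

definition iid :: "'a measure \<Rightarrow> (nat \<Rightarrow> 'a \<Rightarrow> 'd::finite \<Rightarrow> real) \<Rightarrow> bool" where
  "iid M W \<longleftrightarrow>
     prob_space.indep_vars M (\<lambda>_. vecs UNIV) W {1..} \<and>
     (\<forall>n\<ge>1. law M (W n) = law M (W 1))"

definition comp_max :: "(nat \<Rightarrow> 'd \<Rightarrow> real) \<Rightarrow> nat \<Rightarrow> 'd \<Rightarrow> real" where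
  "comp_max w n j = (MAX i\<in>{1..n}. w i j)"

text \<open>
  The \<open>n\<close> i.i.d. copies behind the second maximum are the coordinates of the \<open>n\<close>-fold product of the
  common law. Only \<open>\<tau>\<close> with strictly positive components are considered.
\<close>

definition extremal_index ::
  "'a measure \<Rightarrow> (nat \<Rightarrow> 'a \<Rightarrow> 'd::finite \<Rightarrow> real) \<Rightarrow> (('d \<Rightarrow> real) \<Rightarrow> real) \<Rightarrow> bool" where
  "extremal_index M W \<theta> \<longleftrightarrow> stationary M W \<and>
     (\<forall>\<tau>. (\<forall>j. 0 < \<tau> j) \<longrightarrow> \<theta> \<tau> \<in> {0..1} \<and>
       (\<exists>(u :: nat \<Rightarrow> 'd \<Rightarrow> real) \<gamma>.
          (\<forall>j. (\<lambda>n. real n * (1 - cdf (distr M borel (\<lambda>\<omega>. W n \<omega> j)) (u n j))) \<longlonglongrightarrow> \<tau> j) \<and>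
          (\<lambda>n. measure (PiM {1..n} (\<lambda>_. law M (W 1)))
             {w \<in> space (PiM {1..n} (\<lambda>_. law M (W 1))). \<forall>j. comp_max w n j \<le> u n j})
            \<longlonglongrightarrow> \<gamma> \<and>
          (\<lambda>n. measure M {\<omega> \<in> space M. \<forall>j. comp_max (\<lambda>i. W i \<omega>) n j \<le> u n j})
            \<longlonglongrightarrow> \<gamma> powr \<theta> \<tau>))"

definition pMAX ::
  "(nat \<Rightarrow> 'a \<Rightarrow> 'd \<Rightarrow> real) \<Rightarrow> (nat \<Rightarrow> 'a \<Rightarrow> 'd \<Rightarrow> real) \<Rightarrow> ('d \<Rightarrow> real)
     \<Rightarrow> nat \<Rightarrow> 'a \<Rightarrow> 'd \<Rightarrow> real" where
  "pMAX X Z \<alpha> n \<omega> j = max (X n \<omega> j) (Z n \<omega> j powr (1 / \<alpha> j))"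

text \<open>
  The filter of \<open>t\<^sub>j \<down> 0\<close> jointly over \<open>j \<notin> A\<close>, with \<open>t = \<tau>\<close> on \<open>A\<close>. It is written without
  \<open>at _ within _\<close> so that for \<open>A = UNIV\<close> it is the principal filter of \<open>{\<tau>}\<close> instead of \<open>bot\<close>.
\<close>

definition sub_filter :: "'d::finite set \<Rightarrow> ('d \<Rightarrow> real) \<Rightarrow> ('d \<Rightarrow> real) filter" where
  "sub_filter A \<tau> =
     inf (nhds (\<lambda>j. if j \<in> A then \<tau> j else 0))
         (principal {t. (\<forall>j\<in>A. t j = \<tau> j) \<and> (\<forall>j\<in>-A. 0 < t j)})"

definition sub_extremal_index ::
  "'d::finite set \<Rightarrow> (('d \<Rightarrow> real) \<Rightarrow> real) \<Rightarrow> ('d \<Rightarrow> real) \<Rightarrow> real" where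
  "sub_extremal_index A \<theta> \<tau> = Lim (sub_filter A \<tau>) \<theta>"

definition log_copula :: "'d::finite set \<Rightarrow> ('d \<Rightarrow> real) measure \<Rightarrow> ('d \<Rightarrow> real) \<Rightarrow> real" where
  "log_copula A F \<tau> =
     (if A = {} then 0 else ln (copula A (marginal F A) (\<lambda>j\<in>A. exp (- \<tau> j))))"

end

theory Submission
  imports Defs
begin

text \<open>
  The \<open>j\<close>-th coordinate of the pMAX process is the larger of \<open>X\<^sub>j\<close>, with tail \<open>1 / x\<close>, and a
  power of \<open>Z\<^sub>j\<close>, with tail \<open>1 / x powr \<alpha>\<^sub>j\<close>. The first tail is the heavier one exactly for
  \<open>j \<in> U\<close>. Normalized levels for the pMAX process therefore are \<open>n / \<tau>\<^sub>j\<close> on \<open>U\<close> and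
  \<open>(n / \<tau>\<^sub>j) powr (1 / \<alpha>\<^sub>j)\<close> off \<open>U\<close>. For \<open>X\<close> they have the rates (limits of
  \<open>n\<close> times the exceedance probability) \<open>\<tau>\<^sub>j\<close> on \<open>U\<close> and 0 off \<open>U\<close>,
  and for \<open>Z\<close> the other way round: each sequence sees only its own coordinates.

  By independence the probability that the pMAX maxima stay below the levels is the product of the
  corresponding probabilities for \<open>X\<close> and for \<open>Z\<close> (\<open>pMAX_orthant_prob\<close>), and the same holds
  for independent copies of the pMAX vector. The factors coming from independent vectors are
  \<open>n\<close>-th powers of distribution functions and converge to values of \<open>C\<^sub>G\<close> and \<open>C\<^sub>H\<close> in which
  the arguments with rate 0 are 1 (\<open>attraction_levels\<close>). Such a value is a value of the copula of
  a marginal distribution (\<open>copula_marginal_eq\<close>). This step uses that copulas are determined by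
  their distributions, that is, continuity of the margins: for \<open>G\<close> and \<open>H\<close> it holds because
  the jumps of a max-stable distribution function would overlap (\<open>max_stable_isCont\<close>).

  The remaining factor is the probability for the maxima of the dependent sequence \<open>X\<close> at rates that
  vanish off \<open>U\<close>, a boundary point at which the extremal index of \<open>X\<close> gives no direct
  information. Changing the rates from \<open>s\<close> to \<open>t\<close> changes the limit law of the maxima by at most
  \<open>(\<Sum>j. \<bar>s\<^sub>j - t\<^sub>j\<bar>)\<close>, by a union bound. Approximation by positive rates hence proves
  convergence at the boundary and, after taking logarithms, the existence of the limit that defines
  the index of the sub-vector (\<open>extremal_index_boundary\<close>). If \<open>g\<close>, \<open>h\<close> are the logarithms of
  the two copula values and \<open>\<theta>\<^sub>U\<close> is that limit, then independent copies give
  \<open>exp (g + h)\<close> and the process gives \<open>exp (\<theta>\<^sub>U * g + h)\<close>; the index is the quotient of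
  the exponents.
\<close>

section \<open>Unit Frechet margins\<close>

text \<open>
  The defining property fixes the distribution function on the positive half-line only. There
  \<open>exp (- 1 / x)\<close> vanishes as \<open>x \<down> 0\<close>, so monotonicity leaves no mass on the
  other half-line.
\<close>

lemma unit_frechet_cdf:
  assumes "real_distribution \<mu>" and "unit_frechet \<mu>"
  shows "cdf \<mu> x = (if x > 0 then exp (- 1 / x) else 0)"
proof (cases "x > 0")
  case True
  then show ?thesis using assms(2) by (simp add: unit_frechet_def)
next
  case False
  interpret real_distribution \<mu> by fact
  have "((\<lambda>e::real. exp (- 1 / e)) \<longlongrightarrow> 0) (at_right 0)"
    by real_asymp
  moreover have "\<forall>\<^sub>F e in at_right 0. cdf \<mu> x \<le> exp (- 1 / e)"
    unfolding eventually_at_right_field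
  proof (intro exI[of _ 1] conjI allI impI)
    fix e :: real assume "0 < e"
    then have "cdf \<mu> x \<le> cdf \<mu> e"
      using False by (intro cdf_nondecreasing) auto
    then show "cdf \<mu> x \<le> exp (- 1 / e)"
      using assms(2) \<open>0 < e\<close> by (simp add: unit_frechet_def)
  qed simp
  ultimately have "cdf \<mu> x \<le> 0"
    by (intro tendsto_lowerbound) auto
  then show ?thesis
    using False cdf_nonneg[of x] by auto
qed

lemma unit_frechet_isCont:
  assumes "real_distribution \<mu>" and "unit_frechet \<mu>"
  shows "isCont (cdf \<mu>) x"
proof -
  interpret real_distribution \<mu> by fact
  have eq: "cdf \<mu> = (\<lambda>x. if x > 0 then exp (- 1 / x) else 0)"
    using unit_frechet_cdf[OF assms] by auto
  have "(cdf \<mu> \<longlongrightarrow> cdf \<mu> x) (at_left x)"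
  proof (cases "x > 0")
    case True
    have "((\<lambda>x. exp (- 1 / x)) \<longlongrightarrow> exp (- 1 / x)) (at_left x)"
      using True by (intro tendsto_intros) auto
    moreover have "\<forall>\<^sub>F y in at_left x. exp (- 1 / y) = cdf \<mu> y"
      using eventually_at_left_real[of 0 x] True
      by (auto simp: eq elim!: eventually_mono)
    ultimately have "(cdf \<mu> \<longlongrightarrow> exp (- 1 / x)) (at_left x)"
      by (rule Lim_transform_eventually)
    then show ?thesis using True by (simp add: eq)
  next
    case False
    have "\<forall>\<^sub>F y in at_left x. 0 = cdf \<mu> y"
      using eventually_at_left_real[of "x - 1" x] False
      by (auto simp: eq elim!: eventually_mono)
    then have "(cdf \<mu> \<longlongrightarrow> 0) (at_left x)"
      by (rule Lim_transform_eventually[OF tendsto_const])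
    then show ?thesis using False by (simp add: eq)
  qed
  moreover have "(cdf \<mu> \<longlongrightarrow> cdf \<mu> x) (at_right x)"
    using cdf_is_right_cont[of x] by (simp add: continuous_within)
  ultimately show ?thesis
    by (simp add: isCont_def filterlim_split_at)
qed

section \<open>Comparison of orthant probabilities\<close>

text \<open>
  Comparing two intersections costs the sum of the one-sided differences of their members. The bounds
  on changes of level, on omitted coordinates, and on the loss in the probability integral
  transform all come from this union bound.
\<close>

lemma (in prob_space) prob_INT_diff_le:
  assumes "finite K" and "\<And>k. k \<in> K \<Longrightarrow> E k \<in> events" and "\<And>k. k \<in> K \<Longrightarrow> E' k \<in> events"
  shows "prob {\<omega> \<in> space M. \<forall>k\<in>K. \<omega> \<in> E k} - prob {\<omega> \<in> space M. \<forall>k\<in>K. \<omega> \<in> E' k}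
           \<le> (\<Sum>k\<in>K. prob (E k - E' k))"
proof -
  have e1: "{\<omega> \<in> space M. \<forall>k\<in>K. \<omega> \<in> E k} \<in> events"
    using assms by (intro sets.sets_Collect_finite_All) (auto simp: Int_def[symmetric])
  have e2: "{\<omega> \<in> space M. \<forall>k\<in>K. \<omega> \<in> E' k} \<in> events"
    using assms by (intro sets.sets_Collect_finite_All) (auto simp: Int_def[symmetric])
  have "{\<omega> \<in> space M. \<forall>k\<in>K. \<omega> \<in> E k}
          \<subseteq> {\<omega> \<in> space M. \<forall>k\<in>K. \<omega> \<in> E' k} \<union> (\<Union>k\<in>K. E k - E' k)"
    by auto
  then have "prob {\<omega> \<in> space M. \<forall>k\<in>K. \<omega> \<in> E k}
      \<le> prob ({\<omega> \<in> space M. \<forall>k\<in>K. \<omega> \<in> E' k} \<union> (\<Union>k\<in>K. E k - E' k))"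
    using assms e2 by (intro finite_measure_mono sets.Un sets.finite_UN) auto
  also have "\<dots> \<le> prob {\<omega> \<in> space M. \<forall>k\<in>K. \<omega> \<in> E' k} + prob (\<Union>k\<in>K. E k - E' k)"
    using assms e2 by (intro measure_Un_le sets.finite_UN) auto
  also have "prob (\<Union>k\<in>K. E k - E' k) \<le> (\<Sum>k\<in>K. prob (E k - E' k))"
    using assms by (intro finite_measure_subadditive_finite) auto
  finally show ?thesis by simp
qed

lemma (in prob_space) prob_orthant_diff_le:
  fixes V :: "'k \<Rightarrow> 'a \<Rightarrow> real"
  assumes "finite K" and V: "\<And>k. k \<in> K \<Longrightarrow> V k \<in> borel_measurable M"
  shows "\<bar>prob {\<omega> \<in> space M. \<forall>k\<in>K. V k \<omega> \<le> x k} - prob {\<omega> \<in> space M. \<forall>k\<in>K. V k \<omega> \<le> y k}\<bar>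
           \<le> (\<Sum>k\<in>K. \<bar>cdf (distr M borel (V k)) (x k) - cdf (distr M borel (V k)) (y k)\<bar>)"
proof -
  have *: "prob {\<omega> \<in> space M. \<forall>k\<in>K. V k \<omega> \<le> x k} - prob {\<omega> \<in> space M. \<forall>k\<in>K. V k \<omega> \<le> y k}
           \<le> (\<Sum>k\<in>K. \<bar>cdf (distr M borel (V k)) (x k) - cdf (distr M borel (V k)) (y k)\<bar>)"
    for x y :: "'k \<Rightarrow> real"
  proof -
    let ?E = "\<lambda>x k. {\<omega> \<in> space M. V k \<omega> \<le> x k}"
    have ev: "?E x k \<in> events" if "k \<in> K" for x k
      using V[OF that] by measurable
    have set_eq: "{\<omega> \<in> space M. \<forall>k\<in>K. V k \<omega> \<le> x k} = {\<omega> \<in> space M. \<forall>k\<in>K. \<omega> \<in> ?E x k}" for x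
      by auto
    have "prob {\<omega> \<in> space M. \<forall>k\<in>K. V k \<omega> \<le> x k} - prob {\<omega> \<in> space M. \<forall>k\<in>K. V k \<omega> \<le> y k}
           \<le> (\<Sum>k\<in>K. prob (?E x k - ?E y k))"
      unfolding set_eq
      using ev \<open>finite K\<close> by (intro prob_INT_diff_le) auto
    also have "\<dots> \<le> (\<Sum>k\<in>K. \<bar>cdf (distr M borel (V k)) (x k) - cdf (distr M borel (V k)) (y k)\<bar>)"
    proof (intro sum_mono)
      fix k assume k: "k \<in> K"
      have cdf_eq: "cdf (distr M borel (V k)) c = prob {\<omega> \<in> space M. V k \<omega> \<le> c}" for c
        unfolding cdf_def using V[OF k]
        by (subst measure_distr) (auto intro!: arg_cong[where f = prob])
      show "prob (?E x k - ?E y k) \<le> \<bar>cdf (distr M borel (V k)) (x k) - cdf (distr M borel (V k)) (y k)\<bar>"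
      proof (cases "x k \<le> y k")
        case True
        then have "?E x k - ?E y k = {}" by auto
        then show ?thesis by (simp only:) simp
      next
        case False
        then have "prob (?E x k - ?E y k) = prob (?E x k) - prob (?E y k)"
          using ev[OF k] by (intro finite_measure_Diff) auto
        then show ?thesis by (simp add: cdf_eq)
      qed
    qed
    finally show ?thesis .
  qed
  show ?thesis
    using *[of x y] *[of y x] by (simp add: abs_le_iff abs_minus_commute)
qed

lemma distribution_on_prob_space: "distribution_on A F \<Longrightarrow> prob_space F"
  by (simp add: distribution_on_def)

lemma distribution_on_coordinate:
  assumes "distribution_on A F" and "j \<in> A"
  shows "(\<lambda>x. x j) \<in> borel_measurable F"
proof -
  have "(\<lambda>x. x j) \<in> borel_measurable (vecs A)"
    using assms(2) by measurable
  moreover have "sets F = sets (vecs A)"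
    using assms(1) by (simp add: distribution_on_def)
  ultimately show ?thesis
    using measurable_cong_sets by blast
qed

lemma margin_real_distribution:
  assumes "distribution_on A F" and "j \<in> A"
  shows "real_distribution (margin F j)"
  unfolding margin_def
  using distribution_on_coordinate[OF assms] distribution_on_prob_space[OF assms(1)]
  by (intro prob_space.real_distribution_distr) auto

lemma cdf_margin:
  assumes "distribution_on A F" and "j \<in> A"
  shows "cdf (margin F j) c = measure F {y \<in> space F. y j \<le> c}"
  unfolding cdf_def margin_def using distribution_on_coordinate[OF assms]
  by (subst measure_distr) (auto intro!: arg_cong[where f = "measure F"])

lemma mcdf_diff_le:
  assumes "distribution_on A F" and "finite A"
  shows "\<bar>mcdf A F x - mcdf A F y\<bar>
           \<le> (\<Sum>j\<in>A. \<bar>cdf (margin F j) (x j) - cdf (margin F j) (y j)\<bar>)"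
  unfolding mcdf_def margin_def
  using assms distribution_on_coordinate
  by (intro prob_space.prob_orthant_diff_le) (auto simp: distribution_on_prob_space)

lemma mcdf_drop_diff_le:
  assumes "distribution_on A F" and "finite A" and "B \<subseteq> A"
  shows "\<bar>mcdf B F x - mcdf A F x\<bar> \<le> (\<Sum>j\<in>A - B. 1 - cdf (margin F j) (x j))"
proof -
  interpret prob_space F using assms(1) by (rule distribution_on_prob_space)
  let ?E = "\<lambda>j. {y \<in> space F. y j \<le> x j}"
  let ?E' = "\<lambda>j. if j \<in> B then ?E j else space F"
  have ev: "?E j \<in> events" if "j \<in> A" for j
    using distribution_on_coordinate[OF assms(1) that] by measurable
  have "prob {y \<in> space F. \<forall>j\<in>A. y \<in> ?E' j} - prob {y \<in> space F. \<forall>j\<in>A. y \<in> ?E j}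
      \<le> (\<Sum>j\<in>A. prob (?E' j - ?E j))"
    using assms(2) ev by (intro prob_INT_diff_le) auto
  also have "{y \<in> space F. \<forall>j\<in>A. y \<in> ?E j} = {y \<in> space F. \<forall>j\<in>A. y j \<le> x j}"
    by auto
  also have "{y \<in> space F. \<forall>j\<in>A. y \<in> ?E' j} = {y \<in> space F. \<forall>j\<in>B. y j \<le> x j}"
    using assms(3) by (auto split: if_splits)
  also have "(\<Sum>j\<in>A. prob (?E' j - ?E j)) = (\<Sum>j\<in>A - B. prob (space F - ?E j))"
    using assms(2,3) by (intro sum.mono_neutral_cong_right) auto
  also have "\<dots> = (\<Sum>j\<in>A - B. 1 - cdf (margin F j) (x j))"
    using ev assms(1) by (intro sum.cong refl) (auto simp: prob_compl cdf_margin[of A])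
  finally have "mcdf B F x - mcdf A F x \<le> (\<Sum>j\<in>A - B. 1 - cdf (margin F j) (x j))"
    by (simp add: mcdf_def)
  moreover have "mcdf A F x \<le> mcdf B F x"
  proof -
    have "{y \<in> space F. \<forall>j\<in>B. y j \<le> x j} \<in> events"
      using assms ev finite_subset[OF assms(3,2)]
      by (intro sets.sets_Collect_finite_All) auto
    then show ?thesis
      unfolding mcdf_def using assms(3) by (intro finite_measure_mono) auto
  qed
  ultimately show ?thesis by simp
qed

lemma mcdf_le_margin:
  assumes "distribution_on A F" and "finite A" and "j \<in> A"
  shows "mcdf A F x \<le> cdf (margin F j) (x j)"
proof -
  interpret prob_space F using assms(1) by (rule distribution_on_prob_space)
  have "{y \<in> space F. y j \<le> x j} \<in> events"
    using distribution_on_coordinate[OF assms(1,3)] by measurable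
  then show ?thesis
    unfolding mcdf_def cdf_margin[OF assms(1,3)] using assms(3)
    by (intro finite_measure_mono) auto
qed

lemma mcdf_bounds:
  assumes "distribution_on A F"
  shows "0 \<le> mcdf A F x" and "mcdf A F x \<le> 1"
  using prob_space.prob_le_1[OF distribution_on_prob_space[OF assms]]
  by (auto simp: mcdf_def)

lemma mcdf_tendsto_drop:
  assumes F: "distribution_on A F" and "finite A" and "B \<subseteq> A"
    and in_B: "\<And>N j. j \<in> B \<Longrightarrow> y N j = x j"
    and off_B: "\<And>j. j \<in> A - B \<Longrightarrow> filterlim (\<lambda>N. y N j) at_top \<Phi>"
  shows "((\<lambda>N. mcdf A F (y N)) \<longlongrightarrow> mcdf B F x) \<Phi>"
proof -
  have "((\<lambda>N. \<Sum>j\<in>A - B. 1 - cdf (margin F j) (y N j)) \<longlongrightarrow> (\<Sum>j\<in>A - B. 1 - 1)) \<Phi>"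
  proof (intro tendsto_intros)
    fix j assume j: "j \<in> A - B"
    interpret real_distribution "margin F j"
      using j F by (auto intro: margin_real_distribution)
    show "((\<lambda>N. cdf (margin F j) (y N j)) \<longlongrightarrow> 1) \<Phi>"
      using cdf_lim_at_top_prob off_B[OF j] by (rule filterlim_compose)
  qed
  then have lim0: "((\<lambda>N. \<Sum>j\<in>A - B. 1 - cdf (margin F j) (y N j)) \<longlongrightarrow> 0) \<Phi>"
    by simp
  have "\<bar>mcdf B F x - mcdf A F (y N)\<bar> \<le> (\<Sum>j\<in>A - B. 1 - cdf (margin F j) (y N j))" for N
  proof -
    have "mcdf B F x = mcdf B F (y N)"
      using in_B by (simp add: mcdf_def)
    then show ?thesis using mcdf_drop_diff_le[OF F \<open>finite A\<close> \<open>B \<subseteq> A\<close>] by simp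
  qed
  then have "((\<lambda>N. mcdf A F (y N) - mcdf B F x) \<longlongrightarrow> 0) \<Phi>"
    by (intro Lim_null_comparison[OF _ lim0]) (auto simp: abs_minus_commute)
  then show ?thesis
    by (simp add: LIM_zero_iff)
qed

lemma mcdf_singleton:
  assumes "distribution_on A F" and "j \<in> A"
  shows "mcdf {j} F x = cdf (margin F j) (x j)"
  by (simp add: mcdf_def cdf_margin[OF assms])

section \<open>Copulas of distributions with continuous margins\<close>

lemma cdf_attains:
  assumes "real_distribution \<mu>" and cont: "\<And>x. isCont (cdf \<mu>) x" and "0 < t" "t < 1"
  obtains x where "cdf \<mu> x = t"
proof -
  interpret real_distribution \<mu> by fact
  have "\<forall>\<^sub>F x in at_bot. cdf \<mu> x < t"
    using cdf_lim_at_bot \<open>0 < t\<close> by (rule order_tendstoD)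
  then obtain a where a: "cdf \<mu> a < t"
    by (auto simp: eventually_at_bot_linorder)
  have "\<forall>\<^sub>F x in at_top. t < cdf \<mu> x"
    using cdf_lim_at_top_prob \<open>t < 1\<close> by (rule order_tendstoD)
  then obtain b where b: "t < cdf \<mu> b"
    by (auto simp: eventually_at_top_linorder)
  have "a \<le> b"
    using a b cdf_nondecreasing[of b a] by (cases "a \<le> b") auto
  then show ?thesis
    using IVT[of "cdf \<mu>" a t b] a b cont that by (auto intro: less_imp_le)
qed

lemma cdf_borel_measurable:
  assumes "real_distribution \<mu>"
  shows "cdf \<mu> \<in> borel_measurable borel"
proof -
  interpret real_distribution \<mu> by fact
  show ?thesis
    by (intro borel_measurable_mono monoI cdf_nondecreasing)
qed

text \<open>
  A level \<open>s\<close> near \<open>t\<close> is attained at some \<open>x\<close>, and monotonicity compares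
  \<open>{..x}\<close>, which has mass \<open>s\<close>, with the sublevel set at \<open>t\<close>. Letting
  \<open>s\<close> tend to \<open>t\<close> from above and from below gives the two bounds. Flat stretches of
  the distribution function do no harm, because no inverse is involved.
\<close>

lemma probability_integral_transform:
  assumes "real_distribution \<mu>" and cont: "\<And>x. isCont (cdf \<mu>) x" and t: "t \<in> {0..1}"
  shows "measure \<mu> {y. cdf \<mu> y \<le> t} = t"
proof -
  interpret real_distribution \<mu> by fact
  let ?S = "{y. cdf \<mu> y \<le> t}"
  have S: "?S \<in> sets \<mu>"
    using cdf_borel_measurable[OF assms(1)] by (simp add: events_eq_borel)
  have "prob ?S \<le> s" if "t < s" "s < 1" for s
  proof -
    obtain x where x: "cdf \<mu> x = s"
      using cdf_attains[OF assms(1) cont, of s] \<open>t < s\<close> \<open>s < 1\<close> t by auto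
    have "y \<le> x" if "cdf \<mu> y \<le> t" for y
      using that x \<open>t < s\<close> cdf_nondecreasing[of x y] by (cases "y \<le> x") auto
    then have "?S \<subseteq> {..x}" by auto
    then have "prob ?S \<le> cdf \<mu> x"
      unfolding cdf_def by (intro finite_measure_mono) auto
    then show ?thesis using x by simp
  qed
  then have "prob ?S \<le> t"
    using dense_ge_bounded[of t 1 "prob ?S"] t prob_le_1[of ?S] by (cases "t = 1") auto
  moreover have "s \<le> prob ?S" if "0 < s" "s < t" for s
  proof -
    obtain x where x: "cdf \<mu> x = s"
      using cdf_attains[OF assms(1) cont, of s] \<open>0 < s\<close> \<open>s < t\<close> t by auto
    have "cdf \<mu> y \<le> t" if "y \<le> x" for y
      using cdf_nondecreasing[OF that] x \<open>s < t\<close> by auto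
    then have "{..x} \<subseteq> ?S" by auto
    then have "prob {..x} \<le> prob ?S"
      using S by (rule finite_measure_mono)
    moreover have "prob {..x} = s"
      using x by (simp add: cdf_def)
    ultimately show ?thesis by simp
  qed
  then have "t \<le> prob ?S"
    using dense_le_bounded[of 0 t "prob ?S"] t by (cases "t = 0") auto
  ultimately show ?thesis by simp
qed

text \<open>
  The copula is the distribution function of the transformed vector \<open>(F\<^sub>j (y\<^sub>j))\<^sub>j\<close>, whose
  margins are uniform. The event \<open>y\<^sub>j \<le> x\<^sub>j\<close> is contained in
  \<open>F\<^sub>j (y\<^sub>j) \<le> F\<^sub>j (x\<^sub>j)\<close>, and both have probability
  \<open>F\<^sub>j (x\<^sub>j)\<close>; so they differ by a null set, and passing to the transformed vector loses
  nothing.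
\<close>

lemma sklar_continuous_margins:
  assumes F: "distribution_on A F" and "finite A"
    and cont: "\<And>j x. j \<in> A \<Longrightarrow> isCont (cdf (margin F j)) x"
  shows "\<exists>C. is_copula A C \<and> (\<forall>x. mcdf A F x = C (\<lambda>j\<in>A. cdf (margin F j) (x j)))"
proof -
  interpret prob_space F using F by (rule distribution_on_prob_space)
  let ?T = "\<lambda>y. \<lambda>j\<in>A. cdf (margin F j) (y j)"
  define K where "K = distr F (vecs A) ?T"
  note coord = distribution_on_coordinate[OF F]
  have Fj: "(\<lambda>y. cdf (margin F j) (y j)) \<in> borel_measurable F" if "j \<in> A" for j
    using measurable_compose[OF coord[OF that] cdf_borel_measurable[OF margin_real_distribution[OF F that]]] .
  have T: "?T \<in> measurable F (vecs A)"
    using Fj by (intro measurable_restrict) auto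
  have K: "distribution_on A K"
    using prob_space_distr[OF T] by (simp add: distribution_on_def K_def)
  have transform: "prob {y \<in> space F. cdf (margin F j) (y j) \<le> t} = t"
    if j: "j \<in> A" and t: "t \<in> {0..1}" for j t
  proof -
    note rd = margin_real_distribution[OF F j]
    have "{y. cdf (margin F j) y \<le> t} \<in> sets borel"
      using cdf_borel_measurable[OF rd] by simp
    then have "measure (margin F j) {y. cdf (margin F j) y \<le> t}
        = prob ((\<lambda>y. y j) -` {y. cdf (margin F j) y \<le> t} \<inter> space F)"
      unfolding margin_def using coord[OF j] by (subst measure_distr) (auto simp: margin_def)
    also have "(\<lambda>y. y j) -` {y. cdf (margin F j) y \<le> t} \<inter> space F
        = {y \<in> space F. cdf (margin F j) (y j) \<le> t}"
      by auto
    finally show ?thesis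
      using probability_integral_transform[OF rd cont[OF j] t] by simp
  qed
  have margin_K: "cdf (margin K j) t = t" if j: "j \<in> A" and t: "t \<in> {0..1}" for j t
  proof -
    have "cdf (margin K j) t = measure K {z \<in> space K. z j \<le> t}"
      by (rule cdf_margin[OF K j])
    also have "\<dots> = prob (?T -` {z \<in> space K. z j \<le> t} \<inter> space F)"
    proof -
      have "{z \<in> space (vecs A). z j \<le> t} \<in> sets (vecs A)"
        using j by measurable
      then show ?thesis
        unfolding K_def by (subst measure_distr[OF T]) auto
    qed
    also have "?T -` {z \<in> space K. z j \<le> t} \<inter> space F = {y \<in> space F. cdf (margin F j) (y j) \<le> t}"
      using j by (auto simp: K_def space_PiM)
    finally show ?thesis using transform[OF j t] by simp
  qed
  have "mcdf A F x = mcdf A K (?T x)" for x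
  proof -
    let ?E = "\<lambda>j. {y \<in> space F. cdf (margin F j) (y j) \<le> cdf (margin F j) (x j)}"
    let ?E' = "\<lambda>j. {y \<in> space F. y j \<le> x j}"
    have ev: "?E j \<in> events" "?E' j \<in> events" if "j \<in> A" for j
      using coord[OF that] Fj[OF that] by measurable
    have mono: "?E' j \<subseteq> ?E j" if "j \<in> A" for j
    proof -
      interpret j: real_distribution "margin F j" using F that by (rule margin_real_distribution)
      show ?thesis by (auto intro: j.cdf_nondecreasing)
    qed
    have "prob {y \<in> space F. \<forall>j\<in>A. y \<in> ?E j} - prob {y \<in> space F. \<forall>j\<in>A. y \<in> ?E' j}
        \<le> (\<Sum>j\<in>A. prob (?E j - ?E' j))"
      using ev \<open>finite A\<close> by (intro prob_INT_diff_le)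
    also have "\<dots> = (\<Sum>j\<in>A. 0)"
    proof (intro sum.cong refl)
      fix j assume j: "j \<in> A"
      interpret j: real_distribution "margin F j" using F j by (rule margin_real_distribution)
      have "prob (?E j - ?E' j) = prob (?E j) - prob (?E' j)"
        using ev[OF j] mono[OF j] by (intro finite_measure_Diff)
      also have "prob (?E j) = cdf (margin F j) (x j)"
        using j.cdf_nonneg j.cdf_bounded_prob by (intro transform[OF j]) auto
      also have "prob (?E' j) = cdf (margin F j) (x j)"
        using cdf_margin[OF F j] by simp
      finally show "prob (?E j - ?E' j) = 0" by simp
    qed
    finally have "prob {y \<in> space F. \<forall>j\<in>A. y \<in> ?E j} \<le> prob {y \<in> space F. \<forall>j\<in>A. y \<in> ?E' j}"
      by simp
    moreover have "prob {y \<in> space F. \<forall>j\<in>A. y \<in> ?E' j} \<le> prob {y \<in> space F. \<forall>j\<in>A. y \<in> ?E j}"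
    proof (rule finite_measure_mono)
      show "{y \<in> space F. \<forall>j\<in>A. y \<in> ?E' j} \<subseteq> {y \<in> space F. \<forall>j\<in>A. y \<in> ?E j}"
        using mono by blast
      show "{y \<in> space F. \<forall>j\<in>A. y \<in> ?E j} \<in> events"
        using ev \<open>finite A\<close> by (intro sets.sets_Collect_finite_All) auto
    qed
    moreover have "mcdf A K (?T x) = prob {y \<in> space F. \<forall>j\<in>A. y \<in> ?E j}"
    proof -
      have "mcdf A K (?T x) = prob (?T -` {z \<in> space K. \<forall>j\<in>A. z j \<le> ?T x j} \<inter> space F)"
        unfolding mcdf_def K_def using \<open>finite A\<close> by (subst measure_distr[OF T]) auto
      also have "?T -` {z \<in> space K. \<forall>j\<in>A. z j \<le> ?T x j} \<inter> space F = {y \<in> space F. \<forall>j\<in>A. y \<in> ?E j}"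
        by (auto simp: K_def space_PiM)
      finally show ?thesis .
    qed
    moreover have "mcdf A F x = prob {y \<in> space F. \<forall>j\<in>A. y \<in> ?E' j}"
      by (auto simp: mcdf_def intro!: arg_cong[where f = prob])
    ultimately show ?thesis by simp
  qed
  moreover have "is_copula A (mcdf A K)"
    using K margin_K by (auto simp: is_copula_def)
  ultimately show ?thesis by blast
qed

lemma copula_spec:
  assumes "distribution_on A F" and "finite A"
    and "\<And>j x. j \<in> A \<Longrightarrow> isCont (cdf (margin F j)) x"
  shows "is_copula A (copula A F)"
    and "mcdf A F x = copula A F (\<lambda>j\<in>A. cdf (margin F j) (x j))"
  using someI_ex[OF sklar_continuous_margins[OF assms]] unfolding copula_def[symmetric] by auto

lemma copula_diff_le:
  assumes "is_copula A C" and "finite A"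
    and "\<And>j. j \<in> A \<Longrightarrow> u j \<in> {0..1}" and "\<And>j. j \<in> A \<Longrightarrow> v j \<in> {0..1}"
  shows "\<bar>C u - C v\<bar> \<le> (\<Sum>j\<in>A. \<bar>u j - v j\<bar>)"
proof -
  from assms(1) obtain K where K: "distribution_on A K"
    and m: "\<And>j t. j \<in> A \<Longrightarrow> t \<in> {0..1} \<Longrightarrow> cdf (margin K j) t = t"
    and C: "\<And>u. (\<And>j. j \<in> A \<Longrightarrow> u j \<in> {0..1}) \<Longrightarrow> C u = mcdf A K u"
    unfolding is_copula_def by blast
  have "\<bar>mcdf A K u - mcdf A K v\<bar> \<le> (\<Sum>j\<in>A. \<bar>u j - v j\<bar>)"
    using mcdf_diff_le[OF K \<open>finite A\<close>, of u v] m assms(3,4) by simp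
  then show ?thesis using C assms(3,4) by simp
qed

lemma copula_bounds:
  assumes "is_copula A C" and "\<And>j. j \<in> A \<Longrightarrow> u j \<in> {0..1}"
  shows "0 \<le> C u" and "C u \<le> 1"
proof -
  from assms obtain K where "distribution_on A K" "C u = mcdf A K u"
    unfolding is_copula_def by blast
  then show "0 \<le> C u" "C u \<le> 1" using mcdf_bounds by auto
qed

lemma copula_le_coordinate:
  assumes "is_copula A C" and "finite A" and "\<And>j. j \<in> A \<Longrightarrow> u j \<in> {0..1}" and "j \<in> A"
  shows "C u \<le> u j"
proof -
  from assms obtain K where "distribution_on A K" "C u = mcdf A K u" "cdf (margin K j) (u j) = u j"
    unfolding is_copula_def by metis
  then show ?thesis using mcdf_le_margin[of A K j u] assms(2,4) by simp
qed

lemma copula_one: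
  assumes "is_copula A C" and "finite A" and u: "\<And>j. j \<in> A \<Longrightarrow> u j = 1"
  shows "C u = 1"
proof -
  from assms obtain K where K: "distribution_on A K" "C u = mcdf A K u"
    and m: "\<And>j. j \<in> A \<Longrightarrow> cdf (margin K j) 1 = 1"
    unfolding is_copula_def by (metis atLeastAtMost_iff order_refl zero_le_one)
  have "\<bar>mcdf {} K u - mcdf A K u\<bar> \<le> (\<Sum>j\<in>A - {}. 1 - cdf (margin K j) (u j))"
    using K \<open>finite A\<close> by (intro mcdf_drop_diff_le) auto
  also have "\<dots> = 0" using m u by simp
  finally have "mcdf A K u = mcdf {} K u" by simp
  also have "\<dots> = 1"
    using prob_space.prob_space[OF distribution_on_prob_space[OF K(1)]] by (simp add: mcdf_def)
  finally show ?thesis using K by simp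
qed

section \<open>Continuity of max-stable margins\<close>

text \<open>
  Stability passes from a distribution function to its left limits, so that both end points of a jump
  are raised to the same power.
\<close>

lemma measure_lessThan_affine:
  assumes "real_distribution \<mu>" and "0 < a" and eq: "\<And>x. cdf \<mu> (a * x + b) ^ n = cdf \<mu> x"
  shows "measure \<mu> {..<a * x + b} ^ n = measure \<mu> {..<x}"
proof -
  interpret real_distribution \<mu> by fact
  have "filterlim (\<lambda>y. a * y + b) (at_left (a * x + b)) (at_left x)"
    unfolding filterlim_at
  proof
    show "\<forall>\<^sub>F y in at_left x. a * y + b \<in> {..<a * x + b} \<and> a * y + b \<noteq> a * x + b"
      using \<open>0 < a\<close> eventually_at_left_real[of "x - 1" x] by (auto elim!: eventually_mono)
  qed (intro tendsto_intros)
  then have "((\<lambda>y. cdf \<mu> (a * y + b) ^ n) \<longlongrightarrow> measure \<mu> {..<a * x + b} ^ n) (at_left x)"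
    by (intro tendsto_power filterlim_compose[OF cdf_at_left])
  then show ?thesis
    unfolding eq using cdf_at_left by (rule tendsto_unique[rotated]) simp
qed

text \<open>
  If \<open>F\<close> jumps from \<open>p\<close> to \<open>q\<close> somewhere, then max-stability makes it jump
  from \<open>p\<^sup>r\<close> to \<open>q\<^sup>r\<close> for every positive rational \<open>r\<close>. Jump
  intervals at distinct points do not overlap, but for \<open>r\<close> slightly above 1 the interval
  \<open>(p\<^sup>r, q\<^sup>r)\<close> overlaps \<open>(p, q)\<close> without being equal to it, unless \<open>p = 0\<close>
  and \<open>q = 1\<close>. That remaining case is a point mass.
\<close>

lemma max_stable_isCont:
  assumes "real_distribution \<mu>" and nondeg: "\<And>c. \<mu> \<noteq> return borel c"
    and stable: "\<And>n. n \<ge> 1 \<Longrightarrow> \<exists>a>0. \<exists>b. \<forall>x. cdf \<mu> (a * x + b) ^ n = cdf \<mu> x"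
  shows "isCont (cdf \<mu>) x"
proof -
  interpret real_distribution \<mu> by fact
  \<comment> \<open>\<open>J p q\<close>: the distribution function has left limit \<open>p\<close> and value \<open>q\<close> at some point.\<close>
  define J where "J p q \<longleftrightarrow> (\<exists>x. measure \<mu> {..<x} = p \<and> cdf \<mu> x = q)" for p q
  have J_power: "J (p ^ n) (q ^ n)" if "J p q" "n \<ge> 1" for p q n
  proof -
    from that obtain x where x: "measure \<mu> {..<x} = p" "cdf \<mu> x = q" by (auto simp: J_def)
    obtain a b where ab: "a > 0" "\<And>x. cdf \<mu> (a * x + b) ^ n = cdf \<mu> x"
      using stable[OF \<open>n \<ge> 1\<close>] by blast
    have "a * ((x - b) / a) + b = x" using ab(1) by simp
    then show ?thesis
      unfolding J_def using x ab(2)[of "(x - b) / a"] measure_lessThan_affine[OF assms(1) ab, of "(x - b) / a"]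
      by metis
  qed
  have J_root: "\<exists>p' q'. J p' q' \<and> 0 \<le> p' \<and> 0 \<le> q' \<and> p' ^ n = p \<and> q' ^ n = q"
    if "J p q" "n \<ge> 1" for p q n
  proof -
    from that obtain x where x: "measure \<mu> {..<x} = p" "cdf \<mu> x = q" by (auto simp: J_def)
    obtain a b where ab: "a > 0" "\<And>x. cdf \<mu> (a * x + b) ^ n = cdf \<mu> x"
      using stable[OF \<open>n \<ge> 1\<close>] by blast
    show ?thesis
      unfolding J_def using x ab(2)[of x] measure_lessThan_affine[OF assms(1) ab, of x]
        cdf_nonneg measure_nonneg by blast
  qed
  have J_disjoint: "(p = p' \<and> q = q') \<or> q \<le> p' \<or> q' \<le> p" if jumps: "J p q" "J p' q'" for p q p' q'
  proof -
    obtain x y where x: "measure \<mu> {..<x} = p" "cdf \<mu> x = q"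
      and y: "measure \<mu> {..<y} = p'" "cdf \<mu> y = q'" using jumps by (auto simp: J_def)
    have *: "cdf \<mu> x \<le> measure \<mu> {..<y}" if "x < y" for x y
      unfolding cdf_def using that by (intro finite_measure_mono) auto
    show ?thesis
      using *[of x y] *[of y x] x y by (cases x y rule: linorder_cases) auto
  qed
  show ?thesis
  proof (rule ccontr)
    assume "\<not> isCont (cdf \<mu>) x"
    then have "prob {x} > 0"
      using isCont_cdf[of x] measure_nonneg[of \<mu> "{x}"] by (auto simp: less_le)
    moreover have "cdf \<mu> x = prob {..<x} + prob {x}"
    proof -
      have "{..x} = {..<x} \<union> {x}" by auto
      then show ?thesis unfolding cdf_def by (simp only:) (intro finite_measure_Union, auto)
    qed
    moreover define p q where "p = prob {..<x}" and "q = cdf \<mu> x"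
    ultimately have "p < q" and Jpq: "J p q" by (auto simp: J_def)
    have "0 \<le> p" "q \<le> 1" by (auto simp: p_def q_def cdf_def)
    \<comment> \<open>Here \<open>p * p'\<close> and \<open>q * q'\<close> are the powers of \<open>p\<close> and \<open>q\<close> with exponent \<open>(n + 1) / n\<close>.
      Disjointness of jumps leaves two options: this lower jump ends below \<open>p\<close>, or it is the same jump.\<close>
    have interlaced: "q * q' \<le> p \<or> (p * p' = p \<and> q * q' = q)"
      if "J p' q'" "p' ^ n = p" "q' ^ n = q" "n \<ge> 1" "0 \<le> p'" "0 \<le> q'" for p' q' n
    proof -
      have "J (p * p') (q * q')"
        using J_power[OF that(1), of "Suc n"] that(2,3) by (simp add: mult.commute)
      moreover have "p' \<le> 1"
        using that(1) by (auto simp: J_def)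
      then have "p * p' < q"
        using \<open>p < q\<close> \<open>0 \<le> p\<close> mult_left_le[of p' p] by linarith
      ultimately show ?thesis using J_disjoint[OF _ Jpq, of "p * p'" "q * q'"] by auto
    qed
    show False
    proof (cases "q < 1")
      case True
      \<comment> \<open>For \<open>q < 1\<close> it is never the same jump; as \<open>n\<close> grows the upper ends tend to \<open>q > p\<close>.\<close>
      have "q * root n q \<le> p" if "n \<ge> 1" for n
      proof -
        obtain p' q' where *: "J p' q'" "0 \<le> p'" "0 \<le> q'" "p' ^ n = p" "q' ^ n = q"
          using J_root[OF Jpq \<open>n \<ge> 1\<close>] by blast
        then have "q' \<noteq> 1" using True by auto
        then have "q * q' \<noteq> q" using \<open>p < q\<close> \<open>0 \<le> p\<close> by simp
        then have "q * q' \<le> p" using interlaced[OF *(1,4,5) that *(2,3)] by auto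
        moreover have "root n q = q'"
          using * that by (metis real_root_power_cancel less_eq_Suc_le One_nat_def)
        ultimately show ?thesis by simp
      qed
      then have "\<forall>\<^sub>F n in sequentially. q * root n q \<le> p"
        by (auto simp: eventually_sequentially)
      moreover have "(\<lambda>n. q * root n q) \<longlonglongrightarrow> q * 1"
        using \<open>p < q\<close> \<open>0 \<le> p\<close> by (intro tendsto_intros LIMSEQ_root_const) auto
      ultimately have "q * 1 \<le> p"
        by (intro tendsto_upperbound) auto
      then show False using \<open>p < q\<close> by simp
    next
      case False
      then have "q = 1" using \<open>q \<le> 1\<close> by simp
      \<comment> \<open>For \<open>q = 1\<close> the squared jump is the same jump, so squaring fixes its lower end, which is below 1.\<close>
      have "p = 0"
        using interlaced[of p q 1] Jpq \<open>0 \<le> p\<close> \<open>p < q\<close> \<open>q = 1\<close> by auto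
      have "cdf \<mu> = cdf (return borel x)"
      proof
        fix y
        have "cdf (return borel x) y = (if x \<le> y then 1 else 0)"
          by (simp add: cdf_def measure_return)
        moreover have "cdf \<mu> y = (if x \<le> y then 1 else 0)"
        proof (cases "x \<le> y")
          case True
          then show ?thesis
            using cdf_nondecreasing[of x y] \<open>q = 1\<close> cdf_bounded_prob[of y] by (simp add: q_def)
        next
          case False
          then have "cdf \<mu> y \<le> prob {..<x}"
            unfolding cdf_def by (intro finite_measure_mono) auto
          then show ?thesis
            using False \<open>p = 0\<close> cdf_nonneg[of y] by (simp add: p_def)
        qed
        ultimately show "cdf \<mu> y = cdf (return borel x) y" by simp
      qed
      moreover have "real_distribution (return borel x)"
        by (simp add: real_distribution_def real_distribution_axioms_def prob_space_return)
      ultimately have "\<mu> = return borel x"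
        by (intro cdf_unique assms(1))
      then show False using nondeg by blast
    qed
  qed
qed

text \<open>
  Sending all coordinates but one to infinity turns the max-stability of the joint distribution into
  that of its margin.
\<close>

lemma mev_margin_isCont:
  fixes G :: "('d::finite \<Rightarrow> real) measure"
  assumes "mev_distribution G"
  shows "isCont (cdf (margin G j)) x"
proof (rule max_stable_isCont)
  have G: "distribution_on UNIV G" using assms by (simp add: mev_distribution_def)
  then show "real_distribution (margin G j)" by (rule margin_real_distribution) simp
  show "margin G j \<noteq> return borel c" for c
    using assms by (simp add: mev_distribution_def)
  fix n :: nat assume "n \<ge> 1"
  then obtain a b where a: "\<And>j. 0 < a j"
    and stable: "\<And>x. mcdf UNIV G (\<lambda>j. a j * x j + b j) ^ n = mcdf UNIV G x"
    using assms unfolding mev_distribution_def by blast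
  have "cdf (margin G j) (a j * x + b j) ^ n = cdf (margin G j) x" for x
  proof -
    let ?y = "\<lambda>N i. if i = j then x else real N"
    have "(\<lambda>N. mcdf UNIV G (?y N)) \<longlonglongrightarrow> mcdf {j} G (\<lambda>_. x)"
      by (rule mcdf_tendsto_drop[OF G]) (auto simp: filterlim_real_sequentially)
    moreover have "filterlim (\<lambda>N. a i * real N + b i) at_top sequentially" for i
      using a[of i]
      by real_asymp
    then have "(\<lambda>N. mcdf UNIV G (\<lambda>i. a i * ?y N i + b i)) \<longlonglongrightarrow> mcdf {j} G (\<lambda>i. a i * x + b i)"
      by (intro mcdf_tendsto_drop[OF G]) auto
    then have "(\<lambda>N. mcdf UNIV G (\<lambda>i. a i * ?y N i + b i) ^ n) \<longlonglongrightarrow> mcdf {j} G (\<lambda>i. a i * x + b i) ^ n"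
      by (rule tendsto_power)
    ultimately show ?thesis
      unfolding stable using LIMSEQ_unique G by (fastforce simp: mcdf_singleton[of UNIV])
  qed
  then show "\<exists>a>0. \<exists>b. \<forall>x. cdf (margin G j) (a * x + b) ^ n = cdf (margin G j) x"
    using a by blast
qed

section \<open>Copulas of marginals of extreme value distributions\<close>

lemma mev_copula:
  fixes G :: "('d::finite \<Rightarrow> real) measure"
  assumes "mev_distribution G"
  shows "is_copula UNIV (copula UNIV G)"
    and "mcdf UNIV G x = copula UNIV G (\<lambda>j. cdf (margin G j) (x j))"
  using copula_spec[of UNIV G] mev_margin_isCont[OF assms] assms
  by (auto simp: mev_distribution_def restrict_UNIV)

lemma marginal_distribution_on:
  assumes "distribution_on UNIV G"
  shows "distribution_on A (marginal G A)"
proof -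
  interpret prob_space G using assms by (rule distribution_on_prob_space)
  have "(\<lambda>x. restrict x A) \<in> measurable (vecs UNIV) (vecs A)"
    by (rule measurable_restrict_subset) simp
  then have "(\<lambda>x. restrict x A) \<in> measurable G (vecs A)"
    using assms measurable_cong_sets unfolding distribution_on_def by blast
  then show ?thesis
    by (simp add: distribution_on_def marginal_def prob_space_distr)
qed

lemma mcdf_marginal:
  assumes "distribution_on UNIV G" and "B \<subseteq> A" and "finite A"
  shows "mcdf B (marginal G A) x = mcdf B G x"
proof -
  have "(\<lambda>x. restrict x A) \<in> measurable (vecs UNIV) (vecs A)"
    by (rule measurable_restrict_subset) simp
  then have meas: "(\<lambda>x. restrict x A) \<in> measurable G (vecs A)"
    using assms measurable_cong_sets unfolding distribution_on_def by blast
  have "{y \<in> space (vecs A). \<forall>j\<in>B. y j \<le> x j} \<in> sets (vecs A)"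
  proof (intro sets.sets_Collect_finite_All)
    show "{y \<in> space (vecs A). y j \<le> x j} \<in> sets (vecs A)" if "j \<in> B" for j
    proof -
      have "j \<in> A" using that assms(2) by auto
      then show ?thesis by measurable
    qed
    show "finite B" using assms finite_subset by blast
  qed
  then have "mcdf B (marginal G A) x
      = measure G ((\<lambda>x. restrict x A) -` {y \<in> space (vecs A). \<forall>j\<in>B. y j \<le> x j} \<inter> space G)"
    unfolding mcdf_def marginal_def by (subst measure_distr[OF meas]) auto
  also have "(\<lambda>x. restrict x A) -` {y \<in> space (vecs A). \<forall>j\<in>B. y j \<le> x j} \<inter> space G
      = {y \<in> space G. \<forall>j\<in>B. y j \<le> x j}"
    using assms(2) by (auto simp: space_PiM)
  finally show ?thesis by (simp add: mcdf_def)
qed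

lemma margin_marginal:
  assumes "distribution_on UNIV (G :: ('d::finite \<Rightarrow> real) measure)" and "j \<in> A"
  shows "margin (marginal G A) j = margin G j"
proof (rule cdf_unique)
  show "real_distribution (margin (marginal G A) j)"
    by (rule margin_real_distribution[OF marginal_distribution_on[OF assms(1)] assms(2)])
  show "real_distribution (margin G j)"
    by (rule margin_real_distribution[OF assms(1)]) simp
  show "cdf (margin (marginal G A) j) = cdf (margin G j)"
  proof
    fix c
    have "mcdf {j} (marginal G A) (\<lambda>_. c) = mcdf {j} G (\<lambda>_. c)"
      using assms by (intro mcdf_marginal) auto
    then show "cdf (margin (marginal G A) j) c = cdf (margin G j) c"
      using mcdf_singleton[OF marginal_distribution_on[OF assms(1)] assms(2)]
        mcdf_singleton[OF assms(1), of j] by simp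
  qed
qed

text \<open>
  Both sides are the joint distribution function of the coordinates in \<open>A\<close> at a point whose
  marginal probabilities are \<open>u\<close>. On the right this appears as the limit when the coordinates
  outside \<open>A\<close> go to infinity, where their marginal probabilities tend to 1.
\<close>

lemma copula_marginal_eq:
  fixes G :: "('d::finite \<Rightarrow> real) measure"
  assumes mev: "mev_distribution G" and u: "\<And>j. j \<in> A \<Longrightarrow> 0 < u j \<and> u j < 1"
  shows "copula A (marginal G A) (\<lambda>j\<in>A. u j) = copula UNIV G (\<lambda>j. if j \<in> A then u j else 1)"
proof -
  have G: "distribution_on UNIV G" using mev by (simp add: mev_distribution_def)
  note rd = margin_real_distribution[OF G UNIV_I]
  have "\<forall>j\<in>A. \<exists>x. cdf (margin G j) x = u j"
    using cdf_attains[OF rd mev_margin_isCont[OF mev]] u by metis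
  then obtain x where x: "\<And>j. j \<in> A \<Longrightarrow> cdf (margin G j) (x j) = u j" by metis
  let ?y = "\<lambda>N j. if j \<in> A then x j else real N"
  let ?v = "\<lambda>j. if j \<in> A then u j else 1"
  have "mcdf A (marginal G A) x = copula A (marginal G A) (\<lambda>j\<in>A. cdf (margin (marginal G A) j) (x j))"
    using copula_spec(2)[OF marginal_distribution_on[OF G], of A x] mev_margin_isCont[OF mev]
    by (simp add: margin_marginal[OF G])
  also have "(\<lambda>j\<in>A. cdf (margin (marginal G A) j) (x j)) = (\<lambda>j\<in>A. u j)"
    using x by (auto simp: margin_marginal[OF G] restrict_def)
  finally have "mcdf A (marginal G A) x = copula A (marginal G A) (\<lambda>j\<in>A. u j)" .
  from trans[OF this[symmetric] mcdf_marginal[OF G subset_refl finite]]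
  have lhs: "copula A (marginal G A) (\<lambda>j\<in>A. u j) = mcdf A G x" .
  have "(\<lambda>N. mcdf UNIV G (?y N)) \<longlonglongrightarrow> mcdf A G x"
    by (rule mcdf_tendsto_drop[OF G]) (auto simp: filterlim_real_sequentially)
  moreover have "(\<lambda>N. mcdf UNIV G (?y N)) \<longlonglongrightarrow> copula UNIV G ?v"
  proof -
    have bounds: "0 \<le> cdf (margin G j) c \<and> cdf (margin G j) c \<le> 1" for j c
    proof -
      interpret real_distribution "margin G j" by (rule rd)
      show ?thesis using cdf_nonneg cdf_bounded_prob by auto
    qed
    have "(\<lambda>N. \<Sum>j\<in>UNIV. \<bar>cdf (margin G j) (?y N j) - ?v j\<bar>) \<longlonglongrightarrow> (\<Sum>j\<in>(UNIV::'d set). 0)"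
    proof (intro tendsto_sum)
      fix j
      interpret real_distribution "margin G j" by (rule rd)
      have "(\<lambda>N. cdf (margin G j) (?y N j)) \<longlonglongrightarrow> ?v j"
        using x filterlim_compose[OF cdf_lim_at_top_prob filterlim_real_sequentially]
        by (cases "j \<in> A") auto
      then have "(\<lambda>N. \<bar>cdf (margin G j) (?y N j) - ?v j\<bar>) \<longlonglongrightarrow> \<bar>?v j - ?v j\<bar>"
        by (intro tendsto_intros)
      then show "(\<lambda>N. \<bar>cdf (margin G j) (?y N j) - ?v j\<bar>) \<longlonglongrightarrow> 0" by simp
    qed
    then have lim0: "(\<lambda>N. \<Sum>j\<in>UNIV. \<bar>cdf (margin G j) (?y N j) - ?v j\<bar>) \<longlonglongrightarrow> 0" by simp
    have "\<bar>mcdf UNIV G (?y N) - copula UNIV G ?v\<bar> \<le> (\<Sum>j\<in>UNIV. \<bar>cdf (margin G j) (?y N j) - ?v j\<bar>)" for N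
      unfolding mev_copula(2)[OF mev]
      using u bounds by (intro copula_diff_le[OF mev_copula(1)[OF mev]]) (auto intro: less_imp_le)
    then have "(\<lambda>N. mcdf UNIV G (?y N) - copula UNIV G ?v) \<longlonglongrightarrow> 0"
      by (intro Lim_null_comparison[OF _ lim0]) auto
    then show ?thesis by (simp add: LIM_zero_iff)
  qed
  ultimately show ?thesis
    unfolding lhs by (rule LIMSEQ_unique)
qed

text \<open>
  Unlike the definition, the right-hand side has no special case for the empty set: there it is the
  logarithm of the value 1 of the copula at the corner of the cube. Assigning the rate 0 to the
  coordinates outside \<open>A\<close> also keeps the dimension fixed when sub-vectors are studied.
\<close>

lemma log_copula_eq:
  fixes G :: "('d::finite \<Rightarrow> real) measure"
  assumes mev: "mev_distribution G" and \<tau>: "\<And>j. 0 < \<tau> j"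
  shows "log_copula A G \<tau> = ln (copula UNIV G (\<lambda>j. exp (- (if j \<in> A then \<tau> j else 0))))"
proof (cases "A = {}")
  case True
  then show ?thesis
    using copula_one[OF mev_copula(1)[OF mev], of "\<lambda>_. 1"] by (simp add: log_copula_def)
next
  case False
  have "(\<lambda>j. exp (- (if j \<in> A then \<tau> j else 0))) = (\<lambda>j. if j \<in> A then exp (- \<tau> j) else 1)"
    by auto
  then show ?thesis
    using False copula_marginal_eq[OF mev, of A "\<lambda>j. exp (- \<tau> j)"] \<tau> by (simp add: log_copula_def)
qed

section \<open>Domains of attraction\<close>

lemma tendsto_n_exp_tail:
  assumes "(\<lambda>n. real n * p n) \<longlonglongrightarrow> t"
  shows "(\<lambda>n. real n * (1 - exp (- p n))) \<longlonglongrightarrow> t"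
proof -
  have "(\<lambda>n. inverse (real n) * (real n * p n)) \<longlonglongrightarrow> 0 * t"
    by (intro tendsto_intros lim_inverse_n assms)
  then have "(\<lambda>n. inverse (real n) * (real n * p n)) \<longlonglongrightarrow> 0" by simp
  then have p0: "p \<longlonglongrightarrow> 0"
    by (rule Lim_transform_eventually) (auto simp: eventually_sequentially intro!: exI[of _ 1])
  \<comment> \<open>The factor by which \<open>1 - exp (- x)\<close> differs from \<open>x\<close>, continued to \<open>x = 0\<close>.\<close>
  define h where "h x = (if x = 0 then 1 else (1 - exp (- x)) / x)" for x :: real
  have "((\<lambda>x::real. (1 - exp (- x)) / x) \<longlongrightarrow> 1) (at 0)"
    by real_asymp
  then have "(h \<longlongrightarrow> h 0) (at 0)"
    by (simp add: h_def) (rule Lim_transform_eventually, auto simp: h_def eventually_at_filter)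
  then have "isCont h 0" by (simp add: isCont_def)
  then have "(\<lambda>n. h (p n)) \<longlonglongrightarrow> h 0"
    using p0 by (rule isCont_tendsto_compose)
  then have "(\<lambda>n. (real n * p n) * h (p n)) \<longlonglongrightarrow> t * h 0"
    using assms by (intro tendsto_mult)
  moreover have "(\<lambda>n. real n * (1 - exp (- p n))) = (\<lambda>n. (real n * p n) * h (p n))"
    by (auto simp: h_def)
  moreover have "h 0 = 1" by (simp add: h_def)
  ultimately show ?thesis by simp
qed

text \<open>
  Since \<open>1 - C u \<le> (\<Sum>j. 1 - u\<^sub>j)\<close> for any copula \<open>C\<close>, the \<open>n\<close>-th powers in
  the domain of attraction condition are at least about \<open>(1 - (\<Sum>j. t\<^sub>j) / n) ^ n\<close>. The
  resulting bound keeps the limit copula positive, so that logarithms of it make sense.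
\<close>

lemma attraction_lower_bound:
  fixes F :: "('d::finite \<Rightarrow> real) measure"
  assumes C: "is_copula UNIV (copula UNIV F)" and F: "in_domain_of_attraction F G"
    and t: "\<And>j. 0 \<le> t j"
  shows "exp (- (\<Sum>j\<in>UNIV. t j)) \<le> copula UNIV G (\<lambda>j. exp (- t j))"
proof -
  let ?u = "\<lambda>n j. exp (- t j) powr (1 / real n)"
  have u_eq: "?u n j = exp (- (t j / real n))" for n j
    by (simp add: powr_def)
  have u: "?u n j \<in> {0..1}" for n j
    using t[of j] unfolding u_eq by simp
  have lim: "(\<lambda>n. copula UNIV F (?u n) ^ n) \<longlonglongrightarrow> copula UNIV G (\<lambda>j. exp (- t j))"
    using F t unfolding in_domain_of_attraction_def by simp
  have "(\<lambda>n. (1 + (- (\<Sum>j\<in>UNIV. t j)) / real n) ^ n) \<longlonglongrightarrow> exp (- (\<Sum>j\<in>UNIV. t j))"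
    by (rule tendsto_exp_limit_sequentially)
  moreover have "\<forall>\<^sub>F n in sequentially.
      (1 + (- (\<Sum>j\<in>UNIV. t j)) / real n) ^ n \<le> copula UNIV F (?u n) ^ n"
  proof -
    have "\<forall>\<^sub>F n in sequentially. (\<Sum>j\<in>UNIV. t j) \<le> real n"
      using filterlim_real_sequentially by (simp add: filterlim_at_top)
    then show ?thesis
      using eventually_gt_at_top[of 0]
    proof eventually_elim
      case (elim n)
      have "\<bar>copula UNIV F (\<lambda>_. 1) - copula UNIV F (?u n)\<bar> \<le> (\<Sum>j\<in>UNIV. \<bar>1 - ?u n j\<bar>)"
        using u by (intro copula_diff_le[OF C]) auto
      also have "\<dots> \<le> (\<Sum>j\<in>UNIV. t j / real n)"
      proof (intro sum_mono)
        fix j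
        have "1 - t j / real n \<le> ?u n j"
          using exp_ge_add_one_self[of "- (t j / real n)"] by (simp add: u_eq)
        then show "\<bar>1 - ?u n j\<bar> \<le> t j / real n" using u[of j n] by simp
      qed
      also have "\<dots> = (\<Sum>j\<in>UNIV. t j) / real n" by (simp add: sum_divide_distrib)
      finally have "1 - (\<Sum>j\<in>UNIV. t j) / real n \<le> copula UNIV F (?u n)"
        using copula_one[OF C, of "\<lambda>_. 1"] by simp
      moreover have "0 \<le> 1 - (\<Sum>j\<in>UNIV. t j) / real n" using elim by simp
      ultimately show ?case by (intro power_mono) auto
    qed
  qed
  ultimately show ?thesis
    using lim by (intro tendsto_le[of sequentially]) auto
qed

text \<open>
  The domain of attraction condition is about the exact levels with marginal probabilities
  \<open>exp (- t\<^sub>j / n)\<close>. Copulas are Lipschitz and an \<open>n\<close>-th power enlarges differences at most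
  by the factor \<open>n\<close>, so levels with the same normalized tails in the limit do as well. A rate
  \<open>t\<^sub>j = 0\<close> describes a level that grows too fast to be exceeded in the limit, and
  the copula then gets the argument 1.
\<close>

lemma attraction_levels:
  fixes F :: "('d::finite \<Rightarrow> real) measure"
  assumes F: "distribution_on UNIV F" and cont: "\<And>j x. isCont (cdf (margin F j)) x"
    and attr: "in_domain_of_attraction F G" and t: "\<And>j. 0 \<le> t j"
    and u: "\<And>j. (\<lambda>n. real n * (1 - cdf (margin F j) (u n j))) \<longlonglongrightarrow> t j"
  shows "(\<lambda>n. mcdf UNIV F (u n) ^ n) \<longlonglongrightarrow> copula UNIV G (\<lambda>j. exp (- t j))"
proof -
  note C = copula_spec[OF F finite cont]
  let ?v = "\<lambda>n j. exp (- t j) powr (1 / real n)"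
  have v_eq: "?v n j = exp (- (t j / real n))" for n j
    by (simp add: powr_def)
  have v: "?v n j \<in> {0..1}" for n j
    using t[of j] unfolding v_eq by simp
  have lim: "(\<lambda>n. copula UNIV F (?v n) ^ n) \<longlonglongrightarrow> copula UNIV G (\<lambda>j. exp (- t j))"
    using attr t unfolding in_domain_of_attraction_def by simp
  have m: "cdf (margin F j) x \<in> {0..1}" for j x
  proof -
    interpret real_distribution "margin F j" by (rule margin_real_distribution[OF F UNIV_I])
    show ?thesis using cdf_nonneg cdf_bounded_prob by auto
  qed
  have "(\<lambda>n. \<Sum>j\<in>UNIV. \<bar>real n * (1 - ?v n j) - real n * (1 - cdf (margin F j) (u n j))\<bar>)
      \<longlonglongrightarrow> (\<Sum>j\<in>(UNIV::'d set). \<bar>t j - t j\<bar>)"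
  proof (intro tendsto_intros u)
    fix j
    have "(\<lambda>n. real n * (t j / real n)) \<longlonglongrightarrow> t j"
      by (rule Lim_transform_eventually[OF tendsto_const])
        (auto simp: eventually_sequentially intro!: exI[of _ 1])
    then show "(\<lambda>n. real n * (1 - ?v n j)) \<longlonglongrightarrow> t j"
      unfolding v_eq by (rule tendsto_n_exp_tail)
  qed
  then have lim0: "(\<lambda>n. \<Sum>j\<in>UNIV. \<bar>real n * (1 - ?v n j) - real n * (1 - cdf (margin F j) (u n j))\<bar>) \<longlonglongrightarrow> 0"
    by simp
  have "\<bar>mcdf UNIV F (u n) ^ n - copula UNIV F (?v n) ^ n\<bar>
      \<le> (\<Sum>j\<in>UNIV. \<bar>real n * (1 - ?v n j) - real n * (1 - cdf (margin F j) (u n j))\<bar>)" for n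
  proof -
    have "\<bar>mcdf UNIV F (u n) ^ n - copula UNIV F (?v n) ^ n\<bar>
        \<le> real n * \<bar>mcdf UNIV F (u n) - copula UNIV F (?v n)\<bar>"
      using norm_power_diff[of "mcdf UNIV F (u n)" "copula UNIV F (?v n)" n]
        mcdf_bounds[OF F, of "u n"] copula_bounds[OF C(1), of "?v n"] v by simp
    also have "\<bar>mcdf UNIV F (u n) - copula UNIV F (?v n)\<bar> \<le> (\<Sum>j\<in>UNIV. \<bar>cdf (margin F j) (u n j) - ?v n j\<bar>)"
      unfolding C(2) restrict_UNIV using v m by (intro copula_diff_le[OF C(1)]) auto
    also have "real n * (\<Sum>j\<in>UNIV. \<bar>cdf (margin F j) (u n j) - ?v n j\<bar>)
       = (\<Sum>j\<in>UNIV. \<bar>real n * (1 - ?v n j) - real n * (1 - cdf (margin F j) (u n j))\<bar>)"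
      unfolding sum_distrib_left
    proof (intro sum.cong refl)
      fix j
      have "real n * (1 - ?v n j) - real n * (1 - cdf (margin F j) (u n j))
          = real n * (cdf (margin F j) (u n j) - ?v n j)" by (simp add: algebra_simps)
      then show "real n * \<bar>cdf (margin F j) (u n j) - ?v n j\<bar>
          = \<bar>real n * (1 - ?v n j) - real n * (1 - cdf (margin F j) (u n j))\<bar>"
        by (simp only:) (simp add: abs_mult)
    qed
    finally show ?thesis by (simp add: mult_left_mono)
  qed
  then have "(\<lambda>n. mcdf UNIV F (u n) ^ n - copula UNIV F (?v n) ^ n) \<longlonglongrightarrow> 0"
    by (intro Lim_null_comparison[OF _ lim0]) auto
  from tendsto_add[OF this lim] show ?thesis by simp
qed

section \<open>Maxima of stationary sequences\<close>

lemma coordinate_measurable: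
  assumes "V \<in> measurable M (vecs UNIV)"
  shows "(\<lambda>\<omega>. V \<omega> j) \<in> borel_measurable M"
  using measurable_compose[OF assms measurable_component_singleton[OF UNIV_I]] .

lemma law_distribution_on:
  assumes "prob_space M" and "V \<in> measurable M (vecs UNIV)"
  shows "distribution_on UNIV (law M V)"
  using prob_space.prob_space_distr[OF assms] by (simp add: distribution_on_def law_def)

lemma margin_law:
  assumes "V \<in> measurable M (vecs UNIV)"
  shows "margin (law M V) j = distr M borel (\<lambda>\<omega>. V \<omega> j)"
  unfolding margin_def law_def using assms by (subst distr_distr) (auto simp: comp_def)

lemma prob_coordinate_le:
  assumes "V \<in> measurable M (vecs UNIV)"
  shows "measure M {\<omega> \<in> space M. V \<omega> j \<le> c} = cdf (margin (law M V) j) c"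
  unfolding margin_law[OF assms] cdf_def using coordinate_measurable[OF assms]
  by (subst measure_distr) (auto intro!: arg_cong[where f = "measure M"])

lemma mcdf_law:
  assumes "V \<in> measurable M (vecs (UNIV :: 'd::finite set))"
  shows "mcdf UNIV (law M V) x = measure M {\<omega> \<in> space M. \<forall>j. V \<omega> j \<le> x j}"
proof -
  have "{y \<in> space (vecs UNIV). \<forall>j::'d. y j \<le> x j} \<in> sets (vecs UNIV)"
    by measurable
  then have "mcdf UNIV (law M V) x
      = measure M (V -` {y \<in> space (vecs UNIV). \<forall>j. y j \<le> x j} \<inter> space M)"
    unfolding mcdf_def law_def by (subst measure_distr[OF assms]) auto
  also have "V -` {y \<in> space (vecs UNIV). \<forall>j. y j \<le> x j} \<inter> space M = {\<omega> \<in> space M. \<forall>j. V \<omega> j \<le> x j}"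
    by (auto simp: space_PiM)
  finally show ?thesis .
qed

lemma process_measurable:
  assumes "\<And>n. n \<ge> 1 \<Longrightarrow> W n \<in> measurable M (vecs UNIV)"
  shows "process W \<in> measurable M processes"
  unfolding process_def using assms by (intro measurable_restrict) auto

lemma stationary_law:
  assumes "stationary M W" and "n \<ge> 1"
  shows "law M (W n) = law M (W 1)"
proof -
  have meas: "process (\<lambda>m. W (m + k)) \<in> measurable M processes" for k
    using assms(1) by (intro process_measurable) (auto simp: stationary_def)
  have law_eq: "law M (W (1 + k)) = distr (distr M processes (process (\<lambda>m. W (m + k)))) (vecs UNIV) (\<lambda>p. p 1)" for k
  proof -
    have "(\<lambda>p. p 1) \<in> measurable processes (vecs UNIV)"
      by (rule measurable_component_singleton) simp
    from distr_distr[OF this meas[of k]] show ?thesis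
      by (simp add: law_def comp_def process_def)
  qed
  have "distr M processes (process (\<lambda>m. W (m + k))) = distr M processes (process (\<lambda>m. W (m + 0)))" for k
    using assms(1) unfolding stationary_def by simp
  then have "law M (W (1 + (n - 1))) = law M (W (1 + 0))"
    unfolding law_eq by simp
  then show ?thesis using assms(2) by simp
qed

lemma comp_max_le_iff:
  assumes "n \<ge> 1"
  shows "comp_max w n j \<le> c \<longleftrightarrow> (\<forall>i\<in>{1..n}. w i j \<le> c)"
  unfolding comp_max_def using assms by (subst Max_le_iff) auto

text \<open>
  A union bound over the \<open>n\<close> time points and all coordinates, which holds under arbitrary
  dependence in time. It shows that the limit law of the maxima depends on the levels only through
  their normalized tails, and that it varies continuously with these.
\<close>

lemma maxima_prob_diff_le:
  fixes W :: "nat \<Rightarrow> 'a \<Rightarrow> 'd::finite \<Rightarrow> real"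
  assumes "prob_space M" and W: "stationary M W" and "n \<ge> 1"
  shows "\<bar>measure M {\<omega> \<in> space M. \<forall>j. comp_max (\<lambda>i. W i \<omega>) n j \<le> x j}
        - measure M {\<omega> \<in> space M. \<forall>j. comp_max (\<lambda>i. W i \<omega>) n j \<le> y j}\<bar>
      \<le> (\<Sum>j\<in>UNIV. \<bar>real n * (1 - cdf (margin (law M (W 1)) j) (x j))
            - real n * (1 - cdf (margin (law M (W 1)) j) (y j))\<bar>)"
proof -
  interpret prob_space M by fact
  let ?F = "\<lambda>j. cdf (margin (law M (W 1)) j)"
  let ?V = "\<lambda>(i, j) \<omega>. W i \<omega> j"
  have W_meas: "W i \<in> measurable M (vecs UNIV)" if "i \<ge> 1" for i
    using W that by (simp add: stationary_def)
  have cdf_V: "cdf (distr M borel (?V (i, j))) = ?F j" if "i \<ge> 1" for i j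
    using margin_law[OF W_meas[OF that], of j] stationary_law[OF W that] by simp
  have eq: "{\<omega> \<in> space M. \<forall>j. comp_max (\<lambda>i. W i \<omega>) n j \<le> x j}
      = {\<omega> \<in> space M. \<forall>k\<in>{1..n} \<times> UNIV. ?V k \<omega> \<le> x (snd k)}" for x
    by (auto simp: comp_max_le_iff[OF \<open>n \<ge> 1\<close>])
  have "\<bar>prob {\<omega> \<in> space M. \<forall>k\<in>{1..n} \<times> UNIV. ?V k \<omega> \<le> x (snd k)}
        - prob {\<omega> \<in> space M. \<forall>k\<in>{1..n} \<times> UNIV. ?V k \<omega> \<le> y (snd k)}\<bar>
      \<le> (\<Sum>k\<in>{1..n} \<times> UNIV. \<bar>cdf (distr M borel (?V k)) (x (snd k)) - cdf (distr M borel (?V k)) (y (snd k))\<bar>)"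
    using coordinate_measurable[OF W_meas] by (intro prob_orthant_diff_le) auto
  also have "\<dots> = (\<Sum>k\<in>{1..n} \<times> UNIV. \<bar>?F (snd k) (x (snd k)) - ?F (snd k) (y (snd k))\<bar>)"
  proof (intro sum.cong refl)
    fix k :: "nat \<times> 'd" assume "k \<in> {1..n} \<times> UNIV"
    then have "1 \<le> fst k" by auto
    from cdf_V[OF this, of "snd k"]
    show "\<bar>cdf (distr M borel (?V k)) (x (snd k)) - cdf (distr M borel (?V k)) (y (snd k))\<bar>
        = \<bar>?F (snd k) (x (snd k)) - ?F (snd k) (y (snd k))\<bar>" by simp
  qed
  also have "\<dots> = (\<Sum>i\<in>{1..n}. \<Sum>j\<in>UNIV. \<bar>?F j (x j) - ?F j (y j)\<bar>)"
    by (subst sum.cartesian_product) (auto intro!: sum.cong)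
  also have "\<dots> = (\<Sum>j\<in>UNIV. \<bar>real n * (1 - ?F j (x j)) - real n * (1 - ?F j (y j))\<bar>)"
  proof -
    have "real n * \<bar>?F j (x j) - ?F j (y j)\<bar> = \<bar>real n * (1 - ?F j (x j)) - real n * (1 - ?F j (y j))\<bar>" for j
    proof -
      have "real n * (1 - ?F j (x j)) - real n * (1 - ?F j (y j)) = real n * (?F j (y j) - ?F j (x j))"
        by (simp add: algebra_simps)
      then show ?thesis by (simp only:) (simp add: abs_mult abs_minus_commute)
    qed
    then show ?thesis by (simp add: sum_distrib_left)
  qed
  finally show ?thesis unfolding eq .
qed

lemma iid_copies_maxima_prob:
  fixes F :: "('d::finite \<Rightarrow> real) measure"
  assumes F: "distribution_on UNIV F" and "n \<ge> 1"
  shows "measure (PiM {1..n} (\<lambda>_. F)) {w \<in> space (PiM {1..n} (\<lambda>_. F)). \<forall>j. comp_max w n j \<le> x j}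
       = mcdf UNIV F x ^ n"
proof -
  interpret F: prob_space F using F by (rule distribution_on_prob_space)
  interpret finite_product_prob_space "\<lambda>_. F" "{1..n}"
    by unfold_locales simp
  let ?A = "{y \<in> space F. \<forall>j. y j \<le> x j}"
  have "{y \<in> space F. y j \<le> x j} \<in> sets F" for j
    using distribution_on_coordinate[OF F UNIV_I] by measurable
  then have A: "?A \<in> sets F"
    by (intro sets.sets_Collect_countable_All) auto
  have "{w \<in> space (PiM {1..n} (\<lambda>_. F)). \<forall>j. comp_max w n j \<le> x j} = Pi\<^sub>E {1..n} (\<lambda>_. ?A)"
    by (auto simp: comp_max_le_iff[OF \<open>n \<ge> 1\<close>] space_PiM PiE_iff extensional_def)
  then show ?thesis
    using prob_times[of "\<lambda>_. ?A"] A by (simp add: mcdf_def)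
qed

section \<open>The extremal index at the boundary of the positive orthant\<close>

text \<open>
  The extremal index describes the maxima only at levels with positive rates \<open>t\<close>, where their
  limit law is \<open>\<gamma> t powr \<theta> t\<close> with \<open>\<gamma> t = C\<^sub>G (exp (- t))\<close>. For levels whose rates
  \<open>s\<close> may vanish in some coordinates, the bound \<open>maxima_prob_diff_le\<close> places all limit
  points of their probabilities within \<open>\<delta> t = (\<Sum>j. \<bar>s\<^sub>j - t\<^sub>j\<bar>)\<close> of
  \<open>\<gamma> t powr \<theta> t\<close>. As \<open>t\<close> tends to \<open>s\<close> this forces convergence of the
  probabilities to some \<open>a\<close>, and of \<open>\<gamma> t powr \<theta> t\<close> to the same \<open>a\<close>. Now
  \<open>\<gamma>\<close> is continuous and positive, and \<open>\<gamma> s < 1\<close> if some rate in \<open>s\<close> is not 0; in that case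
  taking logarithms proves that \<open>\<theta> t\<close> itself converges.
\<close>

lemma extremal_index_boundary:
  fixes X :: "nat \<Rightarrow> 'a \<Rightarrow> 'd::finite \<Rightarrow> real" and \<Phi> :: "('d \<Rightarrow> real) filter"
  assumes M: "prob_space M" and index: "extremal_index M X \<theta>"
    and cont: "\<And>j x. isCont (cdf (margin (law M (X 1)) j)) x"
    and attr: "in_domain_of_attraction (law M (X 1)) G"
    and s: "\<And>j. 0 \<le> s j"
    and u: "\<And>j. (\<lambda>n. real n * (1 - cdf (margin (law M (X 1)) j) (u n j))) \<longlonglongrightarrow> s j"
    and "\<Phi> \<noteq> bot" and to_s: "\<And>j. ((\<lambda>t. t j) \<longlongrightarrow> s j) \<Phi>"
    and pos: "\<forall>\<^sub>F t in \<Phi>. \<forall>j. 0 < t j"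
  obtains a where "copula UNIV G (\<lambda>j. exp (- s j)) \<le> a" and "a \<le> 1"
    and "(\<lambda>n. measure M {\<omega> \<in> space M. \<forall>j. comp_max (\<lambda>i. X i \<omega>) n j \<le> u n j}) \<longlonglongrightarrow> a"
    and "\<And>j. s j \<noteq> 0 \<Longrightarrow> (\<theta> \<longlongrightarrow> ln a / ln (copula UNIV G (\<lambda>j. exp (- s j)))) \<Phi>"
proof -
  interpret prob_space M by fact
  let ?F = "law M (X 1)"
  let ?tail = "\<lambda>u n j. real n * (1 - cdf (margin ?F j) (u n j))"
  let ?P = "\<lambda>u n. prob {\<omega> \<in> space M. \<forall>j. comp_max (\<lambda>i. X i \<omega>) n j \<le> u n j}"
  define \<gamma> where "\<gamma> t = copula UNIV G (\<lambda>j. exp (- t j))" for t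
  define \<delta> where "\<delta> t = (\<Sum>j\<in>UNIV. \<bar>s j - t j\<bar>)" for t
  have stat: "stationary M X" using index by (simp add: extremal_index_def)
  then have meas: "X n \<in> measurable M (vecs UNIV)" if "n \<ge> 1" for n
    using that by (simp add: stationary_def)
  have F: "distribution_on UNIV ?F" using M meas by (intro law_distribution_on) auto
  have mev: "mev_distribution G" using attr by (simp add: in_domain_of_attraction_def)
  note C = mev_copula(1)[OF mev]
  have CF: "is_copula UNIV (copula UNIV ?F)" using copula_spec(1)[OF F finite cont] .
  have \<gamma>_pos: "0 < \<gamma> t" if "\<And>j. 0 \<le> t j" for t
    using attraction_lower_bound[OF CF attr that] unfolding \<gamma>_def
    by (rule less_le_trans[rotated]) simp
  have \<gamma>_less_1: "\<gamma> t < 1" if "\<And>j. 0 \<le> t j" "t j \<noteq> 0" for t j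
  proof -
    have "\<gamma> t \<le> exp (- t j)"
      unfolding \<gamma>_def using that(1) by (intro copula_le_coordinate[OF C]) auto
    also have "\<dots> < 1" using that by (simp add: less_le)
    finally show ?thesis .
  qed
  have \<gamma>_le_1: "\<gamma> t \<le> 1" if "\<And>j. 0 \<le> t j" for t
    unfolding \<gamma>_def using that by (intro copula_bounds[OF C]) auto
  have \<theta>01: "0 \<le> \<theta> t" "\<theta> t \<le> 1" if "\<And>j. 0 < t j" for t
    using index that by (auto simp: extremal_index_def)
  \<comment> \<open>The limit of the maxima of independent copies is not arbitrary: the domain of attraction
    condition identifies it as \<open>\<gamma> t\<close>.\<close>
  have levels: "\<exists>v. (\<forall>j. (\<lambda>n. ?tail v n j) \<longlonglongrightarrow> t j) \<and> (?P v \<longlonglongrightarrow> \<gamma> t powr \<theta> t)"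
    if t: "\<And>j. 0 < t j" for t
  proof -
    obtain v g where
      v: "\<And>j. (\<lambda>n. real n * (1 - cdf (distr M borel (\<lambda>\<omega>. X n \<omega> j)) (v n j))) \<longlonglongrightarrow> t j" and
      g: "(\<lambda>n. measure (PiM {1..n} (\<lambda>_. ?F))
             {w \<in> space (PiM {1..n} (\<lambda>_. ?F)). \<forall>j. comp_max w n j \<le> v n j}) \<longlonglongrightarrow> g" and
      P: "?P v \<longlonglongrightarrow> g powr \<theta> t"
      using index t unfolding extremal_index_def by blast
    have tail: "(\<lambda>n. ?tail v n j) \<longlonglongrightarrow> t j" for j
    proof (rule Lim_transform_eventually[OF v])
      show "\<forall>\<^sub>F n in sequentially. real n * (1 - cdf (distr M borel (\<lambda>\<omega>. X n \<omega> j)) (v n j)) = ?tail v n j"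
        using eventually_ge_at_top[of 1]
      proof eventually_elim
        case (elim n)
        show ?case using margin_law[OF meas[OF elim], of j] stationary_law[OF stat elim] by simp
      qed
    qed
    have "(\<lambda>n. mcdf UNIV ?F (v n) ^ n) \<longlonglongrightarrow> \<gamma> t"
      unfolding \<gamma>_def using t by (intro attraction_levels[OF F cont attr _ tail]) (auto intro: less_imp_le)
    moreover have "(\<lambda>n. mcdf UNIV ?F (v n) ^ n) \<longlonglongrightarrow> g"
    proof (rule Lim_transform_eventually[OF g])
      show "\<forall>\<^sub>F n in sequentially. measure (PiM {1..n} (\<lambda>_. ?F))
             {w \<in> space (PiM {1..n} (\<lambda>_. ?F)). \<forall>j. comp_max w n j \<le> v n j} = mcdf UNIV ?F (v n) ^ n"
        using eventually_ge_at_top[of 1] by eventually_elim (rule iid_copies_maxima_prob[OF F])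
    qed
    ultimately have "g = \<gamma> t" using LIMSEQ_unique by blast
    then show ?thesis using tail P by blast
  qed
  have gap: "(\<lambda>n. \<Sum>j\<in>UNIV. \<bar>?tail u n j - ?tail v n j\<bar>) \<longlonglongrightarrow> \<delta> t"
    if "\<And>j. (\<lambda>n. ?tail v n j) \<longlonglongrightarrow> t j" for v t
    unfolding \<delta>_def by (intro tendsto_intros u that)
  have P_gap: "\<bar>?P u n - ?P v n\<bar> \<le> (\<Sum>j\<in>UNIV. \<bar>?tail u n j - ?tail v n j\<bar>)" if "n \<ge> 1" for v n
    by (rule maxima_prob_diff_le[OF M stat that])
  have "(\<delta> \<longlongrightarrow> (\<Sum>j\<in>(UNIV::'d set). \<bar>s j - s j\<bar>)) \<Phi>"
    unfolding \<delta>_def by (intro tendsto_intros to_s)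
  then have \<delta>: "(\<delta> \<longlongrightarrow> 0) \<Phi>" by simp
  have "Cauchy (?P u)"
  proof (rule metric_CauchyI)
    fix e :: real assume "0 < e"
    have "\<forall>\<^sub>F t in \<Phi>. \<delta> t < e / 4"
      using \<delta> \<open>0 < e\<close> by (intro order_tendstoD) auto
    with pos have "\<forall>\<^sub>F t in \<Phi>. (\<forall>j. 0 < t j) \<and> \<delta> t < e / 4"
      by eventually_elim auto
    then obtain t where t: "\<And>j. 0 < t j" "\<delta> t < e / 4"
      using eventually_happens'[OF \<open>\<Phi> \<noteq> bot\<close>] by blast
    obtain v where v: "\<And>j. (\<lambda>n. ?tail v n j) \<longlonglongrightarrow> t j" and P: "?P v \<longlonglongrightarrow> \<gamma> t powr \<theta> t"
      using levels[of t, OF t(1)] by blast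
    have "\<forall>\<^sub>F n in sequentially. (\<Sum>j\<in>UNIV. \<bar>?tail u n j - ?tail v n j\<bar>) < e / 4"
      using gap[OF v] t(2) by (intro order_tendstoD) auto
    moreover have "\<forall>\<^sub>F n in sequentially. dist (?P v n) (\<gamma> t powr \<theta> t) < e / 4"
      using P \<open>0 < e\<close> by (intro tendstoD) auto
    ultimately have "\<forall>\<^sub>F n in sequentially. dist (?P u n) (\<gamma> t powr \<theta> t) < e / 2"
      using eventually_ge_at_top[of 1]
    proof eventually_elim
      case (elim n)
      show ?case using P_gap[OF elim(3), of v] elim(1,2) unfolding dist_real_def by linarith
    qed
    then obtain N where N: "\<And>n. n \<ge> N \<Longrightarrow> dist (?P u n) (\<gamma> t powr \<theta> t) < e / 2"
      unfolding eventually_sequentially by blast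
    show "\<exists>N. \<forall>m\<ge>N. \<forall>n\<ge>N. dist (?P u m) (?P u n) < e"
    proof (intro exI allI impI)
      fix m n assume "N \<le> m" "N \<le> n"
      from N[OF this(1)] N[OF this(2)] show "dist (?P u m) (?P u n) < e"
        by (rule dist_triangle_half_l)
    qed
  qed
  then obtain a where a: "?P u \<longlonglongrightarrow> a"
    using Cauchy_convergent convergent_def by blast
  have close: "\<bar>\<gamma> t powr \<theta> t - a\<bar> \<le> \<delta> t" if t: "\<And>j. 0 < t j" for t
  proof -
    obtain v where v: "\<And>j. (\<lambda>n. ?tail v n j) \<longlonglongrightarrow> t j" and P: "?P v \<longlonglongrightarrow> \<gamma> t powr \<theta> t"
      using levels[of t, OF t] by blast
    have "(\<lambda>n. \<bar>?P u n - ?P v n\<bar>) \<longlonglongrightarrow> \<bar>a - \<gamma> t powr \<theta> t\<bar>"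
      by (intro tendsto_intros a P)
    moreover have "\<forall>\<^sub>F n in sequentially. \<bar>?P u n - ?P v n\<bar> \<le> (\<Sum>j\<in>UNIV. \<bar>?tail u n j - ?tail v n j\<bar>)"
      using eventually_ge_at_top[of 1] by eventually_elim (rule P_gap)
    ultimately have "\<bar>a - \<gamma> t powr \<theta> t\<bar> \<le> \<delta> t"
      using gap[OF v] by (intro tendsto_le[of sequentially]) auto
    then show ?thesis by (simp add: abs_minus_commute)
  qed
  have L_lim: "((\<lambda>t. \<gamma> t powr \<theta> t) \<longlongrightarrow> a) \<Phi>"
  proof -
    have "((\<lambda>t. \<gamma> t powr \<theta> t - a) \<longlongrightarrow> 0) \<Phi>"
    proof (rule Lim_null_comparison[OF _ \<delta>])
      show "\<forall>\<^sub>F t in \<Phi>. norm (\<gamma> t powr \<theta> t - a) \<le> \<delta> t"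
        using pos
      proof eventually_elim
        case (elim t)
        then show ?case using close[of t] by simp
      qed
    qed
    then show ?thesis by (simp add: LIM_zero_iff)
  qed
  have \<gamma>_lim: "(\<gamma> \<longlongrightarrow> \<gamma> s) \<Phi>"
  proof -
    have "((\<lambda>t. \<Sum>j\<in>UNIV. \<bar>exp (- t j) - exp (- s j)\<bar>)
        \<longlongrightarrow> (\<Sum>j\<in>(UNIV::'d set). \<bar>exp (- s j) - exp (- s j)\<bar>)) \<Phi>"
      by (intro tendsto_intros to_s)
    then have lim0: "((\<lambda>t. \<Sum>j\<in>UNIV. \<bar>exp (- t j) - exp (- s j)\<bar>) \<longlongrightarrow> 0) \<Phi>" by simp
    have "\<forall>\<^sub>F t in \<Phi>. norm (\<gamma> t - \<gamma> s) \<le> (\<Sum>j\<in>UNIV. \<bar>exp (- t j) - exp (- s j)\<bar>)"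
      using pos
    proof eventually_elim
      case (elim t)
      show ?case
        unfolding \<gamma>_def real_norm_def using elim s
        by (intro copula_diff_le[OF C]) (auto intro: less_imp_le)
    qed
    then have "((\<lambda>t. \<gamma> t - \<gamma> s) \<longlongrightarrow> 0) \<Phi>"
      using lim0 by (rule Lim_null_comparison)
    then show ?thesis by (simp add: LIM_zero_iff)
  qed
  \<comment> \<open>The bound \<open>\<theta> t \<le> 1\<close> keeps \<open>a\<close> away from 0, where the logarithm would break down.\<close>
  have "\<forall>\<^sub>F t in \<Phi>. \<gamma> t \<le> \<gamma> t powr \<theta> t"
    using pos
  proof eventually_elim
    case (elim t)
    then have "0 < \<gamma> t" "\<gamma> t \<le> 1" using \<gamma>_pos \<gamma>_le_1 less_imp_le by metis+
    then show ?case using powr_mono'[of "\<theta> t" 1 "\<gamma> t"] \<theta>01[of t] elim by simp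
  qed
  then have "\<gamma> s \<le> a"
    using \<gamma>_lim L_lim \<open>\<Phi> \<noteq> bot\<close> by (intro tendsto_le[of \<Phi>]) auto
  moreover have "a \<le> 1"
    using a by (rule LIMSEQ_le_const2) auto
  moreover have "(\<theta> \<longlongrightarrow> ln a / ln (\<gamma> s)) \<Phi>" if "s j \<noteq> 0" for j
  proof -
    have "0 < a" using \<gamma>_pos[of s] s \<open>\<gamma> s \<le> a\<close> by (meson less_le_trans)
    have "0 < \<gamma> s" "\<gamma> s < 1" using \<gamma>_pos[of s] \<gamma>_less_1[of s] s that by auto
    then have "((\<lambda>t. ln (\<gamma> t powr \<theta> t) / ln (\<gamma> t)) \<longlongrightarrow> ln a / ln (\<gamma> s)) \<Phi>"
      using \<open>0 < a\<close> by (intro tendsto_intros L_lim \<gamma>_lim) auto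
    moreover have "\<forall>\<^sub>F t in \<Phi>. ln (\<gamma> t powr \<theta> t) / ln (\<gamma> t) = \<theta> t"
      using pos
    proof eventually_elim
      case (elim t)
      then have "0 < \<gamma> t" "\<gamma> t < 1"
        using \<gamma>_pos[of t] \<gamma>_less_1[of t j] by (auto simp: less_le)
      then show ?case by (simp add: ln_powr)
    qed
    ultimately show ?thesis by (rule Lim_transform_eventually)
  qed
  ultimately show ?thesis using that a unfolding \<gamma>_def by blast
qed

section \<open>Stationarity and maxima of the pMAX process\<close>

lemma shift_measurable:
  "(\<lambda>p. \<lambda>n\<in>{1..}. p (n + k)) \<in> measurable processes processes"
  by (intro measurable_restrict measurable_component_singleton) auto

lemma process_shift:
  "process (\<lambda>n. W (n + k)) = (\<lambda>p. \<lambda>n\<in>{1..}. p (n + k)) \<circ> process W"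
  by (auto simp: process_def fun_eq_iff)

lemma iid_measurable:
  assumes "prob_space M" and "iid M Z" and "n \<ge> 1"
  shows "Z n \<in> measurable M (vecs UNIV)"
proof -
  interpret prob_space M by fact
  show ?thesis using assms(2,3) by (auto simp: iid_def indep_vars_def)
qed

text \<open>
  The law of the whole sequence is a product of equal factors, and such a product does not change when
  its coordinates are reindexed by a shift.
\<close>

lemma iid_stationary:
  assumes "prob_space M" and Z: "iid M Z"
  shows "stationary M Z"
  unfolding stationary_def
proof (intro conjI allI impI)
  interpret prob_space M by fact
  note meas = iid_measurable[OF assms]
  show "Z n \<in> measurable M (vecs UNIV)" if "1 \<le> n" for n using that by (rule meas)
  fix k
  let ?S = "\<lambda>p. \<lambda>n\<in>{1::nat..}. p (n + k)"
  let ?L = "law M (Z 1)"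
  interpret L: prob_space ?L
    using law_distribution_on[OF \<open>prob_space M\<close> meas[OF order_refl]] by (rule distribution_on_prob_space)
  have indep: "indep_vars (\<lambda>_. vecs UNIV) Z {1..}"
    using Z by (simp only: iid_def)
  have "distr M processes (process Z) = PiM {1..} (\<lambda>i. distr M (vecs UNIV) (Z i))"
    unfolding process_def[abs_def]
    by (rule iffD1[OF indep_vars_iff_distr_eq_PiM' indep]) (use meas in auto)
  also have "\<dots> = PiM {1..} (\<lambda>_. ?L)"
  proof (intro PiM_cong refl)
    fix i :: nat assume "i \<in> {1..}"
    then have "i \<ge> 1" by simp
    then show "distr M (vecs UNIV) (Z i) = ?L"
      using Z unfolding iid_def law_def by blast
  qed
  finally have prod: "distr M processes (process Z) = PiM {1..} (\<lambda>_. ?L)" .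
  have sets_L: "sets (PiM {1..} (\<lambda>_. ?L)) = sets processes"
    by (intro sets_PiM_cong) (auto simp: law_def)
  have "distr M processes (process (\<lambda>n. Z (n + k))) = distr (distr M processes (process Z)) processes ?S"
    unfolding process_shift by (intro distr_distr[symmetric] shift_measurable process_measurable meas)
  also have "\<dots> = distr (PiM {1..} (\<lambda>_. ?L)) (PiM {1..} (\<lambda>_. ?L)) ?S"
    unfolding prod using sets_L by (intro distr_cong) auto
  also have "\<dots> = PiM {1..} (\<lambda>_. ?L)"
    by (rule distr_PiM_reindex[of "{1..}" "\<lambda>_. ?L" "\<lambda>n. n + k" "{1..}"]) (rule L.prob_space_axioms, auto)
  finally show "distr M processes (process (\<lambda>n. Z (n + k))) = distr M processes (process Z)"
    unfolding prod .
qed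

lemma pMAX_measurable:
  assumes "X n \<in> measurable M (vecs UNIV)" and "Z n \<in> measurable M (vecs UNIV)"
  shows "pMAX X Z \<alpha> n \<in> measurable M (vecs UNIV)"
proof -
  have "(\<lambda>\<omega>. max (X n \<omega> j) (Z n \<omega> j powr (1 / \<alpha> j))) \<in> borel_measurable M" for j
    using assms[THEN coordinate_measurable, of j] by measurable
  then have "(\<lambda>\<omega> j. pMAX X Z \<alpha> n \<omega> j) \<in> measurable M (vecs UNIV)"
    unfolding pMAX_def by (rule measurable_abs_UNIV)
  then show ?thesis by simp
qed

text \<open>
  The pMAX process is one measurable function \<open>\<phi>\<close> of the pair of input processes, and \<open>\<phi>\<close>
  commutes with time shifts. By independence the law of the shifted pair is the product of the two
  shifted laws, hence it is the law of the original pair.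
\<close>

lemma pMAX_stationary:
  assumes "prob_space M" and X: "stationary M X" and Z: "stationary M Z"
    and indep: "prob_space.indep_var M processes (process X) processes (process Z)"
  shows "stationary M (pMAX X Z \<alpha>)"
  unfolding stationary_def
proof (intro conjI allI impI)
  interpret prob_space M by fact
  have meas: "X n \<in> measurable M (vecs UNIV)" "Z n \<in> measurable M (vecs UNIV)" if "n \<ge> 1" for n
    using X Z that by (auto simp: stationary_def)
  show "pMAX X Z \<alpha> n \<in> measurable M (vecs UNIV)" if "1 \<le> n" for n
    using meas[OF that] by (rule pMAX_measurable)
  fix k
  define \<phi> :: "(nat \<Rightarrow> 'b \<Rightarrow> real) \<times> (nat \<Rightarrow> 'b \<Rightarrow> real) \<Rightarrow> nat \<Rightarrow> 'b \<Rightarrow> real"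
    where "\<phi> r = (\<lambda>n\<in>{1..}. pMAX (\<lambda>n r. fst r n) (\<lambda>n r. snd r n) \<alpha> n r)" for r
  have \<phi>: "\<phi> \<in> measurable (processes \<Otimes>\<^sub>M processes) processes"
    unfolding \<phi>_def
  proof (intro measurable_restrict pMAX_measurable)
    fix n :: nat assume "n \<in> {1..}"
    then show "(\<lambda>r. fst r n) \<in> measurable (processes \<Otimes>\<^sub>M processes) (vecs UNIV)"
      and "(\<lambda>r. snd r n) \<in> measurable (processes \<Otimes>\<^sub>M processes) (vecs UNIV)"
      by (auto intro!: measurable_compose[OF measurable_fst] measurable_compose[OF measurable_snd]
          measurable_component_singleton)
  qed
  let ?X = "\<lambda>k. process (\<lambda>n. X (n + k))" and ?Z = "\<lambda>k. process (\<lambda>n. Z (n + k))"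
  have proc: "process (\<lambda>n. pMAX X Z \<alpha> (n + k)) = \<phi> \<circ> (\<lambda>\<omega>. (?X k \<omega>, ?Z k \<omega>))" for k
    by (auto simp: process_def \<phi>_def pMAX_def fun_eq_iff)
  have XZ: "?X k \<in> measurable M processes" "?Z k \<in> measurable M processes" for k
    by (intro process_measurable meas; simp)+
  have "distr M processes (process (\<lambda>n. pMAX X Z \<alpha> (n + k)))
      = distr (distr M processes (process X) \<Otimes>\<^sub>M distr M processes (process Z)) processes \<phi>" for k
  proof -
    have "distr M processes (process (\<lambda>n. pMAX X Z \<alpha> (n + k)))
        = distr (distr M (processes \<Otimes>\<^sub>M processes) (\<lambda>\<omega>. (?X k \<omega>, ?Z k \<omega>))) processes \<phi>"
      unfolding proc using XZ by (intro distr_distr[symmetric] \<phi> measurable_Pair)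
    also have "distr M (processes \<Otimes>\<^sub>M processes) (\<lambda>\<omega>. (?X k \<omega>, ?Z k \<omega>))
        = distr M processes (?X k) \<Otimes>\<^sub>M distr M processes (?Z k)"
      using indep_var_compose[OF indep shift_measurable[of k] shift_measurable[of k]]
      unfolding process_shift indep_var_distribution_eq by simp
    also have "\<dots> = distr M processes (process X) \<Otimes>\<^sub>M distr M processes (process Z)"
      using X Z by (simp add: stationary_def)
    finally show ?thesis .
  qed
  from this[of k] this[of 0]
  show "distr M processes (process (\<lambda>n. pMAX X Z \<alpha> (n + k))) = distr M processes (process (pMAX X Z \<alpha>))"
    by simp
qed

lemma unit_frechet_AE_pos:
  assumes "prob_space M" and V: "V \<in> measurable M (vecs UNIV)"
    and fr: "unit_frechet (margin (law M V) j)"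
  shows "AE \<omega> in M. 0 < V \<omega> j"
proof -
  interpret prob_space M by fact
  have "cdf (margin (law M V) j) 0 = prob {\<omega> \<in> space M. V \<omega> j \<le> 0}"
    by (rule prob_coordinate_le[OF V, symmetric])
  moreover have "cdf (margin (law M V) j) 0 = 0"
    using unit_frechet_cdf[OF margin_real_distribution[OF law_distribution_on[OF assms(1,2)] UNIV_I] fr]
    by simp
  ultimately have "prob {\<omega> \<in> space M. \<not> 0 < V \<omega> j} = 0" by (simp add: not_less)
  moreover have "{\<omega> \<in> space M. \<not> 0 < V \<omega> j} \<in> events"
    using coordinate_measurable[OF V] by measurable
  ultimately show ?thesis
    by (intro AE_I[of _ _ "{\<omega> \<in> space M. \<not> 0 < V \<omega> j}"]) (auto simp: emeasure_eq_measure)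
qed

lemma powr_inverse_le_iff:
  assumes "0 < (z::real)" "0 < a" "0 < c"
  shows "z powr (1 / a) \<le> c \<longleftrightarrow> z \<le> c powr a"
proof
  assume "z powr (1 / a) \<le> c"
  then have "(z powr (1 / a)) powr a \<le> c powr a"
    using assms by (intro powr_mono2) auto
  then show "z \<le> c powr a" using assms by (simp add: powr_powr)
next
  assume "z \<le> c powr a"
  then have "z powr (1 / a) \<le> (c powr a) powr (1 / a)"
    using assms by (intro powr_mono2) auto
  then show "z powr (1 / a) \<le> c" using assms by (simp add: powr_powr)
qed

text \<open>
  The time points \<open>I\<close> and the coordinates \<open>A\<close> are left free so that the same factorization
  serves the maxima, the law of a single vector and the univariate margins. The powers of
  \<open>Z\<close> can be inverted only where \<open>Z\<close> is positive, which a unit Frechet variable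
  is almost surely.
\<close>

lemma pMAX_orthant_prob:
  fixes X Z :: "nat \<Rightarrow> 'a \<Rightarrow> 'd::finite \<Rightarrow> real"
  assumes "prob_space M" and X: "stationary M X" and Z: "stationary M Z"
    and indep: "prob_space.indep_var M processes (process X) processes (process Z)"
    and Z_frechet: "\<And>j. unit_frechet (margin (law M (Z 1)) j)"
    and \<alpha>: "\<And>j. 0 < \<alpha> j" and I: "finite I" "I \<subseteq> {1..}" and u: "\<And>j. 0 < u j"
  shows "measure M {\<omega> \<in> space M. \<forall>i\<in>I. \<forall>j\<in>A. pMAX X Z \<alpha> i \<omega> j \<le> u j}
       = measure M {\<omega> \<in> space M. \<forall>i\<in>I. \<forall>j\<in>A. X i \<omega> j \<le> u j}
         * measure M {\<omega> \<in> space M. \<forall>i\<in>I. \<forall>j\<in>A. Z i \<omega> j \<le> u j powr \<alpha> j}"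
proof -
  interpret prob_space M by fact
  have I1: "i \<ge> 1" if "i \<in> I" for i using I(2) that by auto
  have meas: "X n \<in> measurable M (vecs UNIV)" "Z n \<in> measurable M (vecs UNIV)" if "n \<ge> 1" for n
    using X Z that by (auto simp: stationary_def)
  have pos: "AE \<omega> in M. \<forall>i\<in>I. \<forall>j. 0 < Z i \<omega> j"
  proof (intro AE_finite_allI I(1))
    fix i assume "i \<in> I"
    have "AE \<omega> in M. 0 < Z i \<omega> j" for j
      using Z_frechet stationary_law[OF Z I1[OF \<open>i \<in> I\<close>]]
      by (intro unit_frechet_AE_pos meas \<open>prob_space M\<close> I1[OF \<open>i \<in> I\<close>]) simp
    then show "AE \<omega> in M. \<forall>j. 0 < Z i \<omega> j" by (simp add: AE_all_countable)
  qed
  let ?B = "\<lambda>v. {p \<in> space processes. \<forall>i\<in>I. \<forall>j\<in>A. p i j \<le> v j}"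
  have B: "?B v \<in> sets processes" for v :: "'d \<Rightarrow> real"
  proof (intro sets.sets_Collect_finite_All I(1) finite)
    fix i and j :: 'd assume "i \<in> I"
    then have "i \<in> {1..}" using I(2) by auto
    then have "(\<lambda>p. p i) \<in> measurable processes (vecs UNIV)"
      by (rule measurable_component_singleton)
    then have "(\<lambda>p. p i j) \<in> borel_measurable processes"
      by (rule coordinate_measurable)
    then show "{p \<in> space processes. p i j \<le> v j} \<in> sets processes" by measurable
  qed
  have event: "process W -` ?B v \<inter> space M = {\<omega> \<in> space M. \<forall>i\<in>I. \<forall>j\<in>A. W i \<omega> j \<le> v j}"
    if "\<And>n. n \<ge> 1 \<Longrightarrow> W n \<in> measurable M (vecs UNIV)" for W v
    using measurable_space[OF process_measurable[of W, OF that]] I1 by (auto simp: process_def)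
  let ?u\<alpha> = "\<lambda>j. u j powr \<alpha> j"
  have X_event: "process X -` ?B u \<inter> space M = {\<omega> \<in> space M. \<forall>i\<in>I. \<forall>j\<in>A. X i \<omega> j \<le> u j}"
    by (rule event) (rule meas(1))
  have Z_event: "process Z -` ?B ?u\<alpha> \<inter> space M = {\<omega> \<in> space M. \<forall>i\<in>I. \<forall>j\<in>A. Z i \<omega> j \<le> ?u\<alpha> j}"
    by (rule event) (rule meas(2))
  have in_events: "{\<omega> \<in> space M. \<forall>i\<in>I. \<forall>j\<in>A. W i \<omega> j \<le> v j} \<in> events"
    if "\<And>n. n \<ge> 1 \<Longrightarrow> W n \<in> measurable M (vecs UNIV)" for W v
  proof -
    have "process W -` ?B v \<inter> space M \<in> events"
      by (intro measurable_sets[OF _ B] process_measurable that)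
    also have "process W -` ?B v \<inter> space M = {\<omega> \<in> space M. \<forall>i\<in>I. \<forall>j\<in>A. W i \<omega> j \<le> v j}"
      by (rule event) (rule that)
    finally show ?thesis .
  qed
  have "prob {\<omega> \<in> space M. \<forall>i\<in>I. \<forall>j\<in>A. pMAX X Z \<alpha> i \<omega> j \<le> u j}
      = prob ((\<lambda>\<omega>. (process X \<omega>, process Z \<omega>)) -` (?B u \<times> ?B ?u\<alpha>) \<inter> space M)"
  proof (rule finite_measure_eq_AE)
    have eq: "(\<lambda>\<omega>. (process X \<omega>, process Z \<omega>)) -` (?B u \<times> ?B ?u\<alpha>) \<inter> space M
        = {\<omega> \<in> space M. \<forall>i\<in>I. \<forall>j\<in>A. X i \<omega> j \<le> u j} \<inter> {\<omega> \<in> space M. \<forall>i\<in>I. \<forall>j\<in>A. Z i \<omega> j \<le> ?u\<alpha> j}"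
      unfolding X_event[symmetric] Z_event[symmetric] by auto
    show "(\<lambda>\<omega>. (process X \<omega>, process Z \<omega>)) -` (?B u \<times> ?B ?u\<alpha>) \<inter> space M \<in> events"
      unfolding eq using meas by (intro sets.Int in_events)
    show "{\<omega> \<in> space M. \<forall>i\<in>I. \<forall>j\<in>A. pMAX X Z \<alpha> i \<omega> j \<le> u j} \<in> events"
      using meas by (intro in_events pMAX_measurable)
    show "AE \<omega> in M. \<omega> \<in> {\<omega> \<in> space M. \<forall>i\<in>I. \<forall>j\<in>A. pMAX X Z \<alpha> i \<omega> j \<le> u j} \<longleftrightarrow>
        \<omega> \<in> (\<lambda>\<omega>. (process X \<omega>, process Z \<omega>)) -` (?B u \<times> ?B ?u\<alpha>) \<inter> space M"
      using pos unfolding eq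
    proof eventually_elim
      case (elim \<omega>)
      have "Z i \<omega> j powr (1 / \<alpha> j) \<le> u j \<longleftrightarrow> Z i \<omega> j \<le> ?u\<alpha> j" if "i \<in> I" for i j
        using elim that \<alpha> u by (intro powr_inverse_le_iff) auto
      then show ?case by (auto simp: pMAX_def)
    qed
  qed
  also have "\<dots> = prob (process X -` ?B u \<inter> space M) * prob (process Z -` ?B ?u\<alpha> \<inter> space M)"
    by (rule indep_varD[OF indep B B])
  finally show ?thesis
    unfolding X_event Z_event .
qed

lemma iid_maxima_prob:
  fixes Z :: "nat \<Rightarrow> 'a \<Rightarrow> 'd::finite \<Rightarrow> real"
  assumes "prob_space M" and Z: "iid M Z" and "n \<ge> 1"
  shows "measure M {\<omega> \<in> space M. \<forall>i\<in>{1..n}. \<forall>j\<in>UNIV. Z i \<omega> j \<le> v j} = mcdf UNIV (law M (Z 1)) v ^ n"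
proof -
  interpret prob_space M by fact
  note meas = iid_measurable[OF assms(1,2)]
  let ?A = "{y \<in> space (vecs UNIV). \<forall>j. y j \<le> v j}"
  have A: "?A \<in> sets (vecs UNIV)" by measurable
  have vimage: "Z i -` ?A \<inter> space M = {\<omega> \<in> space M. \<forall>j. Z i \<omega> j \<le> v j}" for i
    by (auto simp: space_PiM)
  have "{\<omega> \<in> space M. \<forall>i\<in>{1..n}. \<forall>j\<in>UNIV. Z i \<omega> j \<le> v j} = (\<Inter>i\<in>{1..n}. Z i -` ?A \<inter> space M)"
    unfolding vimage using \<open>n \<ge> 1\<close> by auto
  also have "prob \<dots> = (\<Prod>i\<in>{1..n}. prob (Z i -` ?A \<inter> space M))"
    using Z \<open>n \<ge> 1\<close> A by (intro indep_varsD) (auto simp: iid_def)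
  also have "\<dots> = (\<Prod>i\<in>{1..n}. mcdf UNIV (law M (Z 1)) v)"
  proof (intro prod.cong refl)
    fix i assume "i \<in> {1..n}"
    then have "i \<ge> 1" by auto
    then show "prob (Z i -` ?A \<inter> space M) = mcdf UNIV (law M (Z 1)) v"
      unfolding vimage
      using mcdf_law[OF meas[OF \<open>i \<ge> 1\<close>], of v]
        stationary_law[OF iid_stationary[OF assms(1,2)] \<open>i \<ge> 1\<close>] by simp
  qed
  finally show ?thesis by simp
qed

section \<open>The filter of the limit defining the sub-vector extremal index\<close>

text \<open>
  The curve that keeps \<open>\<tau>\<close> on \<open>A\<close> and equals \<open>e\<close> elsewhere enters every member of the
  filter as \<open>e \<down> 0\<close>.
\<close>

lemma sub_filter_neq_bot:
  assumes "\<And>j. 0 < \<tau> j"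
  shows "sub_filter A \<tau> \<noteq> bot"
proof -
  define f where "f e = (\<lambda>j. if j \<in> A then \<tau> j else e)" for e :: real
  have "filterlim f (sub_filter A \<tau>) (at_right 0)"
    unfolding sub_filter_def filterlim_inf
  proof
    have "continuous_on UNIV (\<lambda>e. f e j)" for j
      unfolding f_def by (cases "j \<in> A") (auto intro: continuous_intros)
    then have "continuous_on UNIV f"
      by (rule continuous_on_coordinatewise_then_product)
    then have "(f \<longlongrightarrow> f 0) (at_right 0)"
      by (simp add: continuous_on_def filterlim_at_split)
    then show "(f \<longlongrightarrow> (\<lambda>j. if j \<in> A then \<tau> j else 0)) (at_right 0)"
      by (simp add: f_def)
    show "filterlim f (principal {t. (\<forall>j\<in>A. t j = \<tau> j) \<and> (\<forall>j\<in>- A. 0 < t j)}) (at_right 0)"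
      unfolding filterlim_principal using eventually_at_right_less[of 0]
      by eventually_elim (auto simp: f_def)
  qed
  then show ?thesis
    by (metis filterlim_def bot.extremum_uniqueI filtermap_bot_iff trivial_limit_at_right_real)
qed

lemma sub_filter_tendsto:
  "((\<lambda>t. t j) \<longlongrightarrow> (if j \<in> A then \<tau> j else 0)) (sub_filter A \<tau>)"
proof -
  let ?s = "\<lambda>j. if j \<in> A then \<tau> j else 0"
  have "((\<lambda>t. t j) \<longlongrightarrow> ?s j) (at ?s)"
    by (rule continuous_on_product_coordinates[of j, unfolded continuous_on_def, rule_format, OF UNIV_I])
  then have "((\<lambda>t. t j) \<longlongrightarrow> ?s j) (nhds ?s)"
    using tendsto_at_iff_tendsto_nhds[of "\<lambda>t. t j" ?s] by simp
  then show ?thesis unfolding sub_filter_def by (rule tendsto_mono[rotated]) simp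
qed

lemma sub_filter_pos:
  assumes "\<And>j. 0 < \<tau> j"
  shows "\<forall>\<^sub>F t in sub_filter A \<tau>. \<forall>j. 0 < t j"
proof -
  have "\<forall>\<^sub>F t in principal {t. (\<forall>j\<in>A. t j = \<tau> j) \<and> (\<forall>j\<in>- A. 0 < t j)}. \<forall>j. 0 < t j"
    using assms by (auto simp: eventually_principal)
  then show ?thesis unfolding sub_filter_def by (rule filter_leD[rotated]) simp
qed

section \<open>Normalized levels of the pMAX process\<close>

text \<open>
  The maximum has the heavier of the two tails \<open>1 / x\<close> and \<open>1 / x powr a\<close>. The level is the
  point where the heavier one equals \<open>t / n\<close>, so that \<open>t\<close> is the limiting expected
  number of exceedances among \<open>n\<close> observations.
\<close>

definition pMAX_level :: "real \<Rightarrow> real \<Rightarrow> nat \<Rightarrow> real" where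
  "pMAX_level a t n = (if a \<ge> 1 then real n / t else (real n / t) powr (1 / a))"

lemma pMAX_level_pos:
  assumes "0 < t" and "n \<ge> 1"
  shows "0 < pMAX_level a t n"
  using assms by (simp add: pMAX_level_def)

text \<open>
  For an exponent other than 1, each of the two components either has the full rate
  \<open>t\<close> or is never seen in the limit, and the exponent decides which of the two happens.
\<close>

lemma pMAX_level_X_tail:
  assumes "0 < t" and "0 < a"
  shows "(\<lambda>n. real n * (1 / pMAX_level a t n)) \<longlonglongrightarrow> (if a \<ge> 1 then t else 0)"
proof (cases "a \<ge> 1")
  case True
  have "(\<lambda>n. real n * (1 / (real n / t))) \<longlonglongrightarrow> t"
    using \<open>0 < t\<close> by real_asymp
  then show ?thesis using True by (simp add: pMAX_level_def)
next
  case False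
  then have "(\<lambda>n. real n * (1 / (real n / t) powr (1 / a))) \<longlonglongrightarrow> 0"
    using assms not_le[of 1 a] by real_asymp
  then show ?thesis using False by (simp add: pMAX_level_def)
qed

lemma pMAX_level_Z_tail:
  assumes "0 < t" and "0 < a" and "a \<noteq> 1"
  shows "(\<lambda>n. real n * (1 / pMAX_level a t n powr a)) \<longlonglongrightarrow> (if a \<ge> 1 then 0 else t)"
proof (cases "a \<ge> 1")
  case True
  then have "1 < a" using \<open>a \<noteq> 1\<close> by simp
  then have "(\<lambda>n. real n * (1 / (real n / t) powr a)) \<longlonglongrightarrow> 0"
    using \<open>0 < t\<close> by real_asymp
  then show ?thesis using True by (simp add: pMAX_level_def)
next
  case False
  have "(\<lambda>n. real n * (1 / (real n / t))) \<longlonglongrightarrow> t"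
    using \<open>0 < t\<close> by real_asymp
  then show ?thesis using False assms by (simp add: pMAX_level_def powr_powr)
qed

lemma unit_frechet_tail:
  assumes "real_distribution \<mu>" and "unit_frechet \<mu>"
    and pos: "\<And>n. n \<ge> 1 \<Longrightarrow> 0 < l n" and lim: "(\<lambda>n. real n * (1 / l n)) \<longlonglongrightarrow> t"
  shows "(\<lambda>n. real n * (1 - cdf \<mu> (l n))) \<longlonglongrightarrow> t"
proof (rule Lim_transform_eventually[OF tendsto_n_exp_tail[OF lim]])
  show "\<forall>\<^sub>F n in sequentially. real n * (1 - exp (- (1 / l n))) = real n * (1 - cdf \<mu> (l n))"
    using eventually_ge_at_top[of 1]
    by eventually_elim (use pos in \<open>simp add: unit_frechet_cdf[OF assms(1,2)]\<close>)
qed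

section \<open>The extremal index of the pMAX process\<close>

theorem proposition2p3:
  fixes M :: "'a measure"
    and X Z :: "nat \<Rightarrow> 'a \<Rightarrow> 'd::finite \<Rightarrow> real"
    and G H :: "('d \<Rightarrow> real) measure"
    and \<alpha> :: "'d \<Rightarrow> real"
    and \<theta>X :: "('d \<Rightarrow> real) \<Rightarrow> real"
    and U :: "'d set"
  assumes "prob_space M"
    and X_index: "extremal_index M X \<theta>X"
    and X_margins: "\<forall>j. unit_frechet (margin (law M (X 1)) j)"
    and X_attracted: "in_domain_of_attraction (law M (X 1)) G"
    and Z_iid: "iid M Z"
    and Z_margins: "\<forall>j. unit_frechet (margin (law M (Z 1)) j)"
    and Z_attracted: "in_domain_of_attraction (law M (Z 1)) H"
    and X_Z_indep: "prob_space.indep_var M processes (process X) processes (process Z)"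
    and \<alpha>_pos: "\<forall>j. 0 < \<alpha> j"
    and \<alpha>_neq_1: "\<forall>j. \<alpha> j \<noteq> 1"
    and U_eq: "U = {j. \<alpha> j \<ge> 1}"
  shows "(U \<noteq> {} \<longrightarrow>
           (\<forall>\<tau>. (\<forall>j. 0 < \<tau> j) \<longrightarrow>
              (\<theta>X \<longlongrightarrow> sub_extremal_index U \<theta>X \<tau>) (sub_filter U \<tau>))) \<and>
         extremal_index M (pMAX X Z \<alpha>)
           (\<lambda>\<tau>. (sub_extremal_index U \<theta>X \<tau> * log_copula U G \<tau> + log_copula (- U) H \<tau>)
                 / (log_copula U G \<tau> + log_copula (- U) H \<tau>))"
proof -
  interpret prob_space M by fact
  let ?Y = "pMAX X Z \<alpha>" and ?F = "law M (X 1)" and ?K = "law M (Z 1)"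
  have X: "stationary M X" using X_index by (simp add: extremal_index_def)
  have Z: "stationary M Z" using \<open>prob_space M\<close> Z_iid by (rule iid_stationary)
  have Y: "stationary M ?Y" using \<open>prob_space M\<close> X Z X_Z_indep by (rule pMAX_stationary)
  have meas: "X n \<in> measurable M (vecs UNIV)" "Z n \<in> measurable M (vecs UNIV)"
    "?Y n \<in> measurable M (vecs UNIV)" if "n \<ge> 1" for n
    using X Y Z that by (auto simp: stationary_def)
  have F: "distribution_on UNIV ?F" and K: "distribution_on UNIV ?K" and FY: "distribution_on UNIV (law M (?Y 1))"
    by (intro law_distribution_on meas \<open>prob_space M\<close> order_refl)+
  note F_rd = margin_real_distribution[OF F UNIV_I] and K_rd = margin_real_distribution[OF K UNIV_I]
  have F_fr: "unit_frechet (margin ?F j)" and K_fr: "unit_frechet (margin ?K j)" for j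
    using X_margins Z_margins by auto
  note F_cont = unit_frechet_isCont[OF F_rd F_fr] and K_cont = unit_frechet_isCont[OF K_rd K_fr]
  have G: "mev_distribution G" and H: "mev_distribution H"
    using X_attracted Z_attracted by (auto simp: in_domain_of_attraction_def)
  have \<alpha>: "0 < \<alpha> j" "\<alpha> j \<noteq> 1" for j using \<alpha>_pos \<alpha>_neq_1 by auto
  note orthant = pMAX_orthant_prob[OF \<open>prob_space M\<close> X Z X_Z_indep K_fr \<alpha>(1)]
  \<comment> \<open>Rates of the pMAX levels as seen by \<open>X\<close> and by \<open>Z\<close>.\<close>
  let ?s = "\<lambda>\<tau> j. if j \<in> U then \<tau> j else 0" and ?r = "\<lambda>\<tau> j. if j \<in> - U then \<tau> j else 0"
  let ?\<gamma> = "\<lambda>\<tau>. copula UNIV G (\<lambda>j. exp (- ?s \<tau> j))" and ?\<eta> = "\<lambda>\<tau>. copula UNIV H (\<lambda>j. exp (- ?r \<tau> j))"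
  let ?L = "\<lambda>\<tau> n j. pMAX_level (\<alpha> j) (\<tau> j) n"
  let ?L\<alpha> = "\<lambda>\<tau> n j. ?L \<tau> n j powr \<alpha> j"
  let ?PX = "\<lambda>\<tau> n. prob {\<omega> \<in> space M. \<forall>j. comp_max (\<lambda>i. X i \<omega>) n j \<le> ?L \<tau> n j}"
  have \<gamma>_bounds: "0 < ?\<gamma> \<tau>" "?\<gamma> \<tau> \<le> 1" "\<And>j. j \<in> U \<Longrightarrow> ?\<gamma> \<tau> < 1"
    and \<eta>_bounds: "0 < ?\<eta> \<tau>" "?\<eta> \<tau> \<le> 1" "\<And>j. j \<in> - U \<Longrightarrow> ?\<eta> \<tau> < 1"
    if \<tau>: "\<And>j. 0 < \<tau> j" for \<tau>
  proof -
    have nonneg: "0 \<le> ?s \<tau> j" "0 \<le> ?r \<tau> j" for j using \<tau>[of j] by auto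
    show "0 < ?\<gamma> \<tau>"
      using attraction_lower_bound[OF copula_spec(1)[OF F finite F_cont] X_attracted nonneg(1)]
      by (rule less_le_trans[rotated]) simp
    show "0 < ?\<eta> \<tau>"
      using attraction_lower_bound[OF copula_spec(1)[OF K finite K_cont] Z_attracted nonneg(2)]
      by (rule less_le_trans[rotated]) simp
    have cube: "exp (- ?s \<tau> j) \<in> {0..1}" "exp (- ?r \<tau> j) \<in> {0..1}" for j
      using nonneg[of j] by simp_all
    show "?\<gamma> \<tau> \<le> 1" "?\<eta> \<tau> \<le> 1"
      by (rule copula_bounds(2)[OF mev_copula(1)[OF G] cube(1)], rule copula_bounds(2)[OF mev_copula(1)[OF H] cube(2)])
    have le: "?\<gamma> \<tau> \<le> exp (- ?s \<tau> j)" "?\<eta> \<tau> \<le> exp (- ?r \<tau> j)" for j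
      by (rule copula_le_coordinate[OF mev_copula(1)[OF G] finite cube(1) UNIV_I],
          rule copula_le_coordinate[OF mev_copula(1)[OF H] finite cube(2) UNIV_I])
    show "?\<gamma> \<tau> < 1" if "j \<in> U" for j
      using le_less_trans[OF le(1)[of j], of 1] that \<tau>[of j] by simp
    show "?\<eta> \<tau> < 1" if "j \<in> - U" for j
      using le_less_trans[OF le(2)[of j], of 1] that \<tau>[of j] by simp
  qed
  have X_tail: "(\<lambda>n. real n * (1 - cdf (margin ?F j) (?L \<tau> n j))) \<longlonglongrightarrow> ?s \<tau> j"
    and Z_tail: "(\<lambda>n. real n * (1 - cdf (margin ?K j) (?L\<alpha> \<tau> n j))) \<longlonglongrightarrow> ?r \<tau> j"
    if \<tau>: "\<And>j. 0 < \<tau> j" for \<tau> j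
  proof -
    show "(\<lambda>n. real n * (1 - cdf (margin ?F j) (?L \<tau> n j))) \<longlonglongrightarrow> ?s \<tau> j"
      using pMAX_level_X_tail[OF \<tau> \<alpha>(1), of j j] U_eq
      by (intro unit_frechet_tail[OF F_rd F_fr] pMAX_level_pos \<tau>) simp_all
    show "(\<lambda>n. real n * (1 - cdf (margin ?K j) (?L\<alpha> \<tau> n j))) \<longlonglongrightarrow> ?r \<tau> j"
    proof (intro unit_frechet_tail[OF K_rd K_fr])
      show "0 < ?L\<alpha> \<tau> n j" if "n \<ge> 1" for n
        using pMAX_level_pos[OF \<tau> that, of "\<alpha> j" j] by simp
      show "(\<lambda>n. real n * (1 / ?L\<alpha> \<tau> n j)) \<longlonglongrightarrow> ?r \<tau> j"
        using pMAX_level_Z_tail[OF \<tau> \<alpha>, of j j] U_eq by (cases "1 \<le> \<alpha> j") simp_all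
    qed
  qed
  \<comment> \<open>If \<open>U\<close> is empty then all rates seen by \<open>X\<close> vanish, which squeezes \<open>a\<close> between 1 and 1;
    the product with the sub-vector index is then 0 whatever value that index has.\<close>
  have boundary: "\<exists>a. ?\<gamma> \<tau> \<le> a \<and> a \<le> 1 \<and> ?PX \<tau> \<longlonglongrightarrow> a \<and>
      sub_extremal_index U \<theta>X \<tau> * log_copula U G \<tau> = ln a \<and>
      (U \<noteq> {} \<longrightarrow> (\<theta>X \<longlongrightarrow> sub_extremal_index U \<theta>X \<tau>) (sub_filter U \<tau>))"
    if \<tau>: "\<And>j. 0 < \<tau> j" for \<tau>
  proof -
    note nonbot = sub_filter_neq_bot[of \<tau> U, OF \<tau>]
    have nonneg: "0 \<le> ?s \<tau> j" for j using \<tau>[of j] by auto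
    obtain a where a: "?\<gamma> \<tau> \<le> a" "a \<le> 1" "?PX \<tau> \<longlonglongrightarrow> a"
      and \<theta>_lim: "\<And>j. ?s \<tau> j \<noteq> 0 \<Longrightarrow> (\<theta>X \<longlongrightarrow> ln a / ln (?\<gamma> \<tau>)) (sub_filter U \<tau>)"
      by (rule extremal_index_boundary[OF \<open>prob_space M\<close> X_index F_cont X_attracted nonneg X_tail[of \<tau>, OF \<tau>]
            nonbot sub_filter_tendsto sub_filter_pos[of \<tau> U, OF \<tau>]]) blast
    have g: "log_copula U G \<tau> = ln (?\<gamma> \<tau>)"
      using log_copula_eq[OF G, of \<tau> U] \<tau> by simp
    show ?thesis
    proof (cases "U = {}")
      case True
      then have "?\<gamma> \<tau> = 1"
        using copula_one[OF mev_copula(1)[OF G] finite, of "\<lambda>_. 1"] by simp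
      then have "a = 1" using a(1,2) by simp
      then show ?thesis using a True by (auto simp: log_copula_def)
    next
      case False
      then obtain j where j: "j \<in> U" by blast
      have lim: "(\<theta>X \<longlongrightarrow> ln a / ln (?\<gamma> \<tau>)) (sub_filter U \<tau>)"
        using \<theta>_lim[of j] j \<tau>[of j] by simp
      then have sub: "sub_extremal_index U \<theta>X \<tau> = ln a / ln (?\<gamma> \<tau>)"
        unfolding sub_extremal_index_def by (rule tendsto_Lim[OF nonbot])
      have "ln (?\<gamma> \<tau>) \<noteq> 0" using \<gamma>_bounds[of \<tau>, OF \<tau>] j by (simp add: ln_eq_zero_iff less_le)
      then show ?thesis using a lim unfolding sub g by auto
    qed
  qed
  have "extremal_index M ?Y
           (\<lambda>\<tau>. (sub_extremal_index U \<theta>X \<tau> * log_copula U G \<tau> + log_copula (- U) H \<tau>)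
                 / (log_copula U G \<tau> + log_copula (- U) H \<tau>))"
    unfolding extremal_index_def
  proof (intro conjI Y allI impI)
    fix \<tau> :: "'d \<Rightarrow> real" assume "\<forall>j. 0 < \<tau> j"
    then have \<tau>: "0 < \<tau> j" for j by blast
    obtain a where a: "?\<gamma> \<tau> \<le> a" "a \<le> 1" "?PX \<tau> \<longlonglongrightarrow> a"
      and ln_a: "sub_extremal_index U \<theta>X \<tau> * log_copula U G \<tau> = ln a"
      using boundary[of \<tau>, OF \<tau>] by blast
    note \<gamma> = \<gamma>_bounds[of \<tau>, OF \<tau>] and \<eta> = \<eta>_bounds[of \<tau>, OF \<tau>]
    have "0 < a" using \<gamma>(1) a(1) by simp
    define \<theta> where "\<theta> = (ln a + ln (?\<eta> \<tau>)) / (ln (?\<gamma> \<tau>) + ln (?\<eta> \<tau>))"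
    have \<theta>: "(sub_extremal_index U \<theta>X \<tau> * log_copula U G \<tau> + log_copula (- U) H \<tau>)
        / (log_copula U G \<tau> + log_copula (- U) H \<tau>) = \<theta>"
      unfolding ln_a \<theta>_def using log_copula_eq[OF G, of \<tau> U] log_copula_eq[OF H, of \<tau> "- U"] \<tau> by simp
    have ln_bounds: "ln (?\<gamma> \<tau>) \<le> ln a" "ln a \<le> 0" "ln (?\<gamma> \<tau>) \<le> 0" "ln (?\<eta> \<tau>) \<le> 0"
      using a(1,2) \<open>0 < a\<close> \<gamma>(1,2) \<eta>(1,2) by auto
    \<comment> \<open>\<open>U\<close> and its complement are not both empty, and a nonempty one makes its copula value less than 1.\<close>
    have denom: "ln (?\<gamma> \<tau>) + ln (?\<eta> \<tau>) < 0"
    proof (cases "U = {}")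
      case True
      then have "ln (?\<eta> \<tau>) < 0" using \<eta>(1) \<eta>(3) by simp
      then show ?thesis using ln_bounds by simp
    next
      case False
      then have "ln (?\<gamma> \<tau>) < 0" using \<gamma>(1) \<gamma>(3) by auto
      then show ?thesis using ln_bounds by simp
    qed
    show "(sub_extremal_index U \<theta>X \<tau> * log_copula U G \<tau> + log_copula (- U) H \<tau>)
        / (log_copula U G \<tau> + log_copula (- U) H \<tau>) \<in> {0..1}"
      unfolding \<theta> \<theta>_def using denom ln_bounds
      by (simp add: divide_nonpos_neg divide_le_eq)
    have pos: "0 < ?L \<tau> n j" if "n \<ge> 1" for n j
      using pMAX_level_pos[OF \<tau> that] .
    have Z_lim: "(\<lambda>n. mcdf UNIV ?K (?L\<alpha> \<tau> n) ^ n) \<longlonglongrightarrow> ?\<eta> \<tau>"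
      using Z_tail[of \<tau>, OF \<tau>] \<tau>
      by (intro attraction_levels[OF K K_cont Z_attracted]) (auto intro: less_imp_le)
    have X_lim: "(\<lambda>n. mcdf UNIV ?F (?L \<tau> n) ^ n) \<longlonglongrightarrow> ?\<gamma> \<tau>"
      using X_tail[of \<tau>, OF \<tau>] \<tau>
      by (intro attraction_levels[OF F F_cont X_attracted]) (auto intro: less_imp_le)
    have margins: "(\<lambda>n. real n * (1 - cdf (distr M borel (\<lambda>\<omega>. ?Y n \<omega> j)) (?L \<tau> n j))) \<longlonglongrightarrow> \<tau> j" for j
    proof -
      have "(\<lambda>n. real n * (1 / ?L \<tau> n j) + real n * (1 / ?L\<alpha> \<tau> n j))
          \<longlonglongrightarrow> (if \<alpha> j \<ge> 1 then \<tau> j else 0) + (if \<alpha> j \<ge> 1 then 0 else \<tau> j)"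
        by (intro tendsto_add pMAX_level_X_tail pMAX_level_Z_tail \<tau> \<alpha>)
      then have "(\<lambda>n. real n * (1 / ?L \<tau> n j + 1 / ?L\<alpha> \<tau> n j)) \<longlonglongrightarrow> \<tau> j"
        by (simp add: distrib_left split: if_splits)
      then have lim: "(\<lambda>n. real n * (1 - exp (- (1 / ?L \<tau> n j + 1 / ?L\<alpha> \<tau> n j)))) \<longlonglongrightarrow> \<tau> j"
        by (rule tendsto_n_exp_tail)
      show ?thesis
      proof (rule Lim_transform_eventually[OF lim])
        show "\<forall>\<^sub>F n in sequentially. real n * (1 - exp (- (1 / ?L \<tau> n j + 1 / ?L\<alpha> \<tau> n j)))
            = real n * (1 - cdf (distr M borel (\<lambda>\<omega>. ?Y n \<omega> j)) (?L \<tau> n j))"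
          using eventually_ge_at_top[of 1]
        proof eventually_elim
          case (elim n)
          have "cdf (distr M borel (\<lambda>\<omega>. ?Y n \<omega> j)) (?L \<tau> n j) = prob {\<omega> \<in> space M. ?Y n \<omega> j \<le> ?L \<tau> n j}"
            using prob_coordinate_le[OF meas(3)[OF elim]] margin_law[OF meas(3)[OF elim]] by simp
          also have "\<dots> = prob {\<omega> \<in> space M. X n \<omega> j \<le> ?L \<tau> n j} * prob {\<omega> \<in> space M. Z n \<omega> j \<le> ?L\<alpha> \<tau> n j}"
            using orthant[of "{n}" "?L \<tau> n" "{j}"] elim pos[OF elim] by simp
          also have "\<dots> = cdf (margin ?F j) (?L \<tau> n j) * cdf (margin ?K j) (?L\<alpha> \<tau> n j)"
            using prob_coordinate_le[OF meas(1)[OF elim]] prob_coordinate_le[OF meas(2)[OF elim]]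
              stationary_law[OF X elim] stationary_law[OF Z elim] by simp
          also have "\<dots> = exp (- (1 / ?L \<tau> n j)) * exp (- (1 / ?L\<alpha> \<tau> n j))"
            using pos[OF elim, of j] unit_frechet_cdf[OF F_rd F_fr] unit_frechet_cdf[OF K_rd K_fr] by simp
          also have "\<dots> = exp (- (1 / ?L \<tau> n j + 1 / ?L\<alpha> \<tau> n j))"
            by (simp add: exp_add[symmetric])
          finally show ?case by simp
        qed
      qed
    qed
    have copies: "(\<lambda>n. measure (PiM {1..n} (\<lambda>_. law M (?Y 1)))
             {w \<in> space (PiM {1..n} (\<lambda>_. law M (?Y 1))). \<forall>j. comp_max w n j \<le> ?L \<tau> n j})
            \<longlonglongrightarrow> ?\<gamma> \<tau> * ?\<eta> \<tau>"
    proof (rule Lim_transform_eventually[OF tendsto_mult[OF X_lim Z_lim]])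
      show "\<forall>\<^sub>F n in sequentially. mcdf UNIV ?F (?L \<tau> n) ^ n * mcdf UNIV ?K (?L\<alpha> \<tau> n) ^ n
          = measure (PiM {1..n} (\<lambda>_. law M (?Y 1)))
             {w \<in> space (PiM {1..n} (\<lambda>_. law M (?Y 1))). \<forall>j. comp_max w n j \<le> ?L \<tau> n j}"
        using eventually_ge_at_top[of 1]
      proof eventually_elim
        case (elim n)
        have "mcdf UNIV (law M (?Y 1)) (?L \<tau> n) = mcdf UNIV ?F (?L \<tau> n) * mcdf UNIV ?K (?L\<alpha> \<tau> n)"
          using orthant[of "{1}" "?L \<tau> n" UNIV] pos[OF elim]
          by (simp add: mcdf_law[OF meas(1)] mcdf_law[OF meas(2)] mcdf_law[OF meas(3)])
        then show ?case
          using iid_copies_maxima_prob[OF FY elim] by (simp add: power_mult_distrib)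
      qed
    qed
    have maxima: "(\<lambda>n. prob {\<omega> \<in> space M. \<forall>j. comp_max (\<lambda>i. ?Y i \<omega>) n j \<le> ?L \<tau> n j})
            \<longlonglongrightarrow> a * ?\<eta> \<tau>"
    proof (rule Lim_transform_eventually[OF tendsto_mult[OF a(3) Z_lim]])
      show "\<forall>\<^sub>F n in sequentially. ?PX \<tau> n * mcdf UNIV ?K (?L\<alpha> \<tau> n) ^ n
          = prob {\<omega> \<in> space M. \<forall>j. comp_max (\<lambda>i. ?Y i \<omega>) n j \<le> ?L \<tau> n j}"
        using eventually_ge_at_top[of 1]
      proof eventually_elim
        case (elim n)
        have max_eq: "{\<omega> \<in> space M. \<forall>j. comp_max (\<lambda>i. W i \<omega>) n j \<le> v j}
            = {\<omega> \<in> space M. \<forall>i\<in>{1..n}. \<forall>j\<in>UNIV. W i \<omega> j \<le> v j}" for W v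
          by (auto simp: comp_max_le_iff[OF elim])
        show ?case
          unfolding max_eq iid_maxima_prob[OF \<open>prob_space M\<close> Z_iid elim, symmetric]
          using pos[OF elim] by (intro orthant[symmetric]) auto
      qed
    qed
    have "(?\<gamma> \<tau> * ?\<eta> \<tau>) powr \<theta> = exp (\<theta> * (ln (?\<gamma> \<tau>) + ln (?\<eta> \<tau>)))"
      using \<gamma>(1) \<eta>(1) by (simp add: powr_def ln_mult)
    also have "\<dots> = exp (ln a + ln (?\<eta> \<tau>))"
      unfolding \<theta>_def using denom by simp
    also have "\<dots> = a * ?\<eta> \<tau>"
      using \<open>0 < a\<close> \<eta>(1) by (simp add: exp_add)
    finally have "a * ?\<eta> \<tau> = (?\<gamma> \<tau> * ?\<eta> \<tau>) powr \<theta>" ..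
    with margins copies maxima
    show "\<exists>(u :: nat \<Rightarrow> 'd \<Rightarrow> real) \<gamma>.
          (\<forall>j. (\<lambda>n. real n * (1 - cdf (distr M borel (\<lambda>\<omega>. ?Y n \<omega> j)) (u n j))) \<longlonglongrightarrow> \<tau> j) \<and>
          (\<lambda>n. measure (PiM {1..n} (\<lambda>_. law M (?Y 1)))
             {w \<in> space (PiM {1..n} (\<lambda>_. law M (?Y 1))). \<forall>j. comp_max w n j \<le> u n j})
            \<longlonglongrightarrow> \<gamma> \<and>
          (\<lambda>n. prob {\<omega> \<in> space M. \<forall>j. comp_max (\<lambda>i. ?Y i \<omega>) n j \<le> u n j})
            \<longlonglongrightarrow> \<gamma> powr ((sub_extremal_index U \<theta>X \<tau> * log_copula U G \<tau> + log_copula (- U) H \<tau>)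
                 / (log_copula U G \<tau> + log_copula (- U) H \<tau>))"
      unfolding \<theta> by (intro exI[of _ "?L \<tau>"] exI[of _ "?\<gamma> \<tau> * ?\<eta> \<tau>"]) auto
  qed
  moreover have "U \<noteq> {} \<longrightarrow> (\<forall>\<tau>. (\<forall>j. 0 < \<tau> j) \<longrightarrow>
      (\<theta>X \<longlongrightarrow> sub_extremal_index U \<theta>X \<tau>) (sub_filter U \<tau>))"
    using boundary by blast
  ultimately show ?thesis by blast
qed

end
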